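(* Let $0<q\le1$ and let $T_\phi$ be the Toeplitz operator on $H^2(\mathbb{D})$ with symbol $\phi\in L^\infty(\mathbb{T})$, $\phi$ being harmonic in $\mathbb{D}$ (that is, $\phi$ is identified with its harmonic extension to $\mathbb{D}$). Write $\phi=f+g$ with $f=P_+\phi$ and $g=P_-\phi$, so that $f,\overline{g}\in H^2(\mathbb{D})$. Then $$\mathrm{Ber}_q(T_\phi)=\{q(f(w_2)+g(w_1)):\ w_1\in\mathbb{D},\ w_2\in\mathcal{S}_{w_1}\}.$$
   Context: $\mathbb{D}$ is the open unit disc and $\mathbb{T}$ the unit circle in $\mathbb{C}$. $H^2(\mathbb{D})$ is the Hardy space of analytic functions $\sum_{n\ge0}a_nz^n$ on $\mathbb{D}$ with $\sum|a_n|^2<\infty$ and inner product $\langle\sum a_nz^n,\sum b_nz^n\rangle=\sum a_n\overline{b_n}$; it is identified isometrically with the closed subspace $\widetilde{H}^2$ of $L^2(\mathbb{T})$ (normalized Lebesgue measure) of functions $\sum_{n\ge0}a_ne^{in\theta}$ with $\sum|a_n|^2<\infty$. Its reproducing kernel at $w\in\mathbb{D}$ is $k_w(z)=\frac{1}{1-\overline{w}z}$, and $\hat{k}_w=k_w/\|k_w\|$. $P_+$ is the orthogonal projection of $L^2(\mathbb{T})$ onto $\widetilde{H}^2$ and $P_-=I-P_+$. For $\phi\in L^\infty(\mathbb{T})$, $T_\phi h=P_+(\phi h)$, $h\in\widetilde{H}^2$, regarded as a bounded operator on $H^2(\mathbb{D})$. The values $f(w_2)$ and $g(w_1)$ at points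 of $\mathbb{D}$ are those of the analytic function $f\in H^2(\mathbb{D})$ and of the complex conjugate of the analytic function $\overline{g}\in H^2(\mathbb{D})$. For $0<q\le1$ and $w_1\in\mathbb{D}$, $\mathcal{S}_{w_1}=\{w_2\in\mathbb{D}:\langle\hat{k}_{w_1},\hat{k}_{w_2}\rangle=q\}$, and for a bounded operator $T$ on $H^2(\mathbb{D})$ the $q$-Berezin range is $\mathrm{Ber}_q(T)=\{\langle T\hat{k}_{w_1},\hat{k}_{w_2}\rangle: w_1\in\mathbb{D},\ w_2\in\mathcal{S}_{w_1}\}$. *)

theory Defs
  imports "HOL-Complex_Analysis.Complex_Analysis"
begin

text \<open>
  Elements of the \<open>L\<^sup>p\<close> spaces are represented by Borel functions, with equality almost everywhere
  left implicit; only their values on the unit circle matter.  Likewise an element of the Hardy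
  space is represented by a function on all of the complex plane of which only the values on the
  open unit disc matter.
\<close>

definition circle_measure :: "complex measure" where
  "circle_measure =
     distr (uniform_measure lborel {0..<2 * pi}) (restrict_space borel (sphere 0 1)) cis"

definition circle_L2 :: "(complex \<Rightarrow> complex) set" where
  "circle_L2 = {F \<in> borel_measurable circle_measure.
                  integrable circle_measure (\<lambda>z. (norm (F z))\<^sup>2)}"

definition circle_Linf :: "(complex \<Rightarrow> complex) set" where
  "circle_Linf = {F \<in> borel_measurable circle_measure.
                    \<exists>C. AE z in circle_measure. norm (F z) \<le> C}"

definition circle_inner :: "(complex \<Rightarrow> complex) \<Rightarrow> (complex \<Rightarrow> complex) \<Rightarrow> complex" where
  "circle_inner F G = (LINT z|circle_measure. F z * cnj (G z))"

definition circle_norm :: "(complex \<Rightarrow> complex) \<Rightarrow> real" where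
  "circle_norm F = sqrt (LINT z|circle_measure. (norm (F z))\<^sup>2)"

definition harmonic_extension :: "(complex \<Rightarrow> complex) \<Rightarrow> complex \<Rightarrow> complex" where
  "harmonic_extension F w =
     (LINT z|circle_measure. of_real ((1 - (norm w)\<^sup>2) / (norm (z - w))\<^sup>2) * F z)"

text \<open>\<open>F = (\<Sum>n. a n * z ^ n)\<close> on the circle, with convergence in \<open>L\<^sup>2\<close>.\<close>

definition circle_power_series :: "(nat \<Rightarrow> complex) \<Rightarrow> (complex \<Rightarrow> complex) \<Rightarrow> bool" where
  "circle_power_series a F \<longleftrightarrow> F \<in> circle_L2 \<and>
     (\<lambda>N. circle_norm (\<lambda>z. F z - (\<Sum>n<N. a n * z ^ n))) \<longlonglongrightarrow> 0"

definition hardy_circle :: "(complex \<Rightarrow> complex) set" where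
  "hardy_circle = {F. \<exists>a. summable (\<lambda>n. (norm (a n))\<^sup>2) \<and> circle_power_series a F}"

definition taylor_coeff :: "(complex \<Rightarrow> complex) \<Rightarrow> nat \<Rightarrow> complex" where
  "taylor_coeff h n = fps_nth (fps_expansion h 0) n"

definition hardy_disc :: "(complex \<Rightarrow> complex) set" where
  "hardy_disc = {h. h holomorphic_on ball 0 1 \<and> summable (\<lambda>n. (norm (taylor_coeff h n))\<^sup>2)}"

definition hardy_inner :: "(complex \<Rightarrow> complex) \<Rightarrow> (complex \<Rightarrow> complex) \<Rightarrow> complex" where
  "hardy_inner h k = (\<Sum>n. taylor_coeff h n * cnj (taylor_coeff k n))"

definition hardy_norm :: "(complex \<Rightarrow> complex) \<Rightarrow> real" where
  "hardy_norm h = sqrt (Re (hardy_inner h h))"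

text \<open>
  The isometric identification of the two Hardy spaces, in both directions.  The chosen function
  is unique almost everywhere on the circle, respectively everywhere on the open disc.
\<close>

definition boundary_fun :: "(complex \<Rightarrow> complex) \<Rightarrow> complex \<Rightarrow> complex" where
  "boundary_fun h = (SOME F. circle_power_series (taylor_coeff h) F)"

definition disc_fun :: "(complex \<Rightarrow> complex) \<Rightarrow> complex \<Rightarrow> complex" where
  "disc_fun F = (SOME h. h \<in> hardy_disc \<and> circle_power_series (taylor_coeff h) F)"

text \<open>The orthogonal projection, unique almost everywhere.\<close>

definition P_plus :: "(complex \<Rightarrow> complex) \<Rightarrow> complex \<Rightarrow> complex" where
  "P_plus F = (SOME U. U \<in> hardy_circle \<and>
                 (\<forall>V\<in>hardy_circle. circle_inner (\<lambda>z. F z - U z) V = 0))"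

definition P_minus :: "(complex \<Rightarrow> complex) \<Rightarrow> complex \<Rightarrow> complex" where
  "P_minus F = (\<lambda>z. F z - P_plus F z)"

definition toeplitz ::
    "(complex \<Rightarrow> complex) \<Rightarrow> (complex \<Rightarrow> complex) \<Rightarrow> complex \<Rightarrow> complex" where
  "toeplitz \<phi> h = disc_fun (P_plus (\<lambda>z. \<phi> z * boundary_fun h z))"

definition hardy_kernel :: "complex \<Rightarrow> complex \<Rightarrow> complex" where
  "hardy_kernel w z = 1 / (1 - cnj w * z)"

definition normalized_kernel :: "complex \<Rightarrow> complex \<Rightarrow> complex" where
  "normalized_kernel w z = hardy_kernel w z / of_real (hardy_norm (hardy_kernel w))"

definition berezin_partners :: "real \<Rightarrow> complex \<Rightarrow> complex set" where
  "berezin_partners q w1 =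
     {w2 \<in> ball 0 1. hardy_inner (normalized_kernel w1) (normalized_kernel w2) = of_real q}"

definition berezin_range ::
    "real \<Rightarrow> ((complex \<Rightarrow> complex) \<Rightarrow> complex \<Rightarrow> complex) \<Rightarrow> complex set" where
  "berezin_range q T =
     {hardy_inner (T (normalized_kernel w1)) (normalized_kernel w2) | w1 w2.
        w1 \<in> ball 0 1 \<and> w2 \<in> berezin_partners q w1}"

end

theory Submission
  imports Defs
begin

text \<open>
  For \<open>w1, w2\<close> in the disc put \<open>a = cnj w1 * z\<close> and \<open>b = w2 * cnj z\<close> for \<open>z\<close> on the circle, so that
  \<open>a * b = cnj w1 * w2\<close> does not depend on \<open>z\<close>.  Up to the norms of the two kernels,
  \<open>\<langle>T k\<^sub>1, k\<^sub>2\<rangle>\<close> is the integral of \<open>\<phi> / ((1 - a) (1 - b))\<close>, and the partial fraction identity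
  \<open>1 / ((1 - a) (1 - b)) = (1 / (1 - b) + a / (1 - a)) / (1 - a b)\<close> splits it: the first term pairs
  \<open>\<phi>\<close> with the nonnegative powers and gives \<open>f w2\<close>, the second pairs it with the negative powers and
  gives \<open>g w1\<close>, while the factor \<open>1 / (1 - a b)\<close> is the inner product of the kernels.  That \<open>cnj g\<close> lies
  in the Hardy space needs completeness of the Fourier system in \<open>L\<^sup>2\<close>.
\<close>

subsection \<open>Lebesgue measure on the circle\<close>

lemma space_circle_measure [simp]: "space circle_measure = sphere 0 1"
  by (simp add: circle_measure_def space_restrict_space)

lemma sets_circle_measure [measurable_cong]: "sets circle_measure = sets (restrict_space borel (sphere 0 1))"
  by (simp add: circle_measure_def)

lemma borel_measurable_circle_measure:
  "F \<in> borel_measurable borel \<Longrightarrow> F \<in> borel_measurable circle_measure"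
  by (simp add: measurable_cong_sets[OF sets_circle_measure refl] measurable_restrict_space1)

lemma id_measurable_circle [measurable]: "(\<lambda>z. z) \<in> borel_measurable circle_measure"
  by (rule borel_measurable_circle_measure) simp

lemma cis_measurable_circle [measurable]:
  "cis \<in> measurable (uniform_measure lborel {0..<2 * pi}) (restrict_space borel (sphere 0 1))"
proof -
  have "cis \<in> borel_measurable borel"
    by (intro borel_measurable_continuous_onI continuous_intros)
  then show ?thesis
    by (intro measurable_restrict_space2) auto
qed

lemma emeasure_circle_measure: "emeasure circle_measure (sphere 0 1) = 1"
proof -
  have "emeasure circle_measure (sphere 0 1)
    = emeasure (uniform_measure lborel {0..<2 * pi}) (cis -` sphere 0 1 \<inter> space (uniform_measure lborel {0..<2 * pi}))"
    unfolding circle_measure_def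
    by (rule emeasure_distr) (auto simp: sets_restrict_space image_iff intro!: bexI[of _ UNIV])
  also have "\<dots> = emeasure (uniform_measure lborel {0..<2 * pi}) UNIV"
    by (rule arg_cong[where f="emeasure _"]) auto
  also have "\<dots> = 1"
    by (subst emeasure_uniform_measure) (auto simp: ennreal_divide_self)
  finally show ?thesis .
qed

interpretation circle: finite_measure circle_measure
  by standard (simp add: emeasure_circle_measure)

lemma measure_circle_measure [simp]: "measure circle_measure (sphere 0 1) = 1"
  by (simp add: measure_def emeasure_circle_measure)

lemma integral_circle_measure:
  fixes F :: "complex \<Rightarrow> complex"
  assumes [measurable]: "F \<in> borel_measurable borel"
  shows "(LINT z|circle_measure. F z) = (LINT t|lborel. indicator {0..2 * pi} t *\<^sub>R F (cis t)) / (2 * pi)"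
proof -
  have c [measurable]: "cis \<in> borel_measurable borel"
    by (intro borel_measurable_continuous_onI continuous_intros)
  have "(LINT z|circle_measure. F z) = (LINT t|uniform_measure lborel {0..<2 * pi}. F (cis t))"
    unfolding circle_measure_def by (rule integral_distr) (auto intro: measurable_restrict_space1)
  also have "uniform_measure lborel {0..<2 * pi} = density lborel (\<lambda>t. ennreal (indicator {0..<2 * pi} t / (2 * pi)))"
    by (auto simp: uniform_measure_def indicator_def divide_ennreal[symmetric] ennreal_1 intro!: arg_cong[where f="density _"] ext)
  also have "integral\<^sup>L \<dots> (\<lambda>t. F (cis t)) = (LINT t|lborel. (indicator {0..<2 * pi} t / (2 * pi)) *\<^sub>R F (cis t))"
    by (rule integral_density) auto
  \<comment> \<open>The two integrands differ only at \<open>2 * pi\<close>, a null set. The closed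
    interval is the form that the fundamental theorem of calculus takes in
    \<open>integral_circle_power\<close>.\<close>
  also have "\<dots> = (LINT t|lborel. (indicator {0..2 * pi} t *\<^sub>R F (cis t)) / (2 * pi))"
    by (rule integral_cong_AE)
       (use AE_lborel_singleton[of "2*pi"] in \<open>auto simp: indicator_def scaleR_conv_of_real elim!: eventually_mono\<close>)
  finally show ?thesis by simp
qed

lemma integral_circle_power:
  assumes "n > 0"
  shows "(LINT z|circle_measure. z ^ n) = 0"
proof -
  have "(LINT t|lborel. indicator {0..2 * pi} t *\<^sub>R cis t ^ n) = cis (2*pi) ^ n / (\<i> * n) - cis 0 ^ n / (\<i> * n)"
  proof (rule integral_FTC_Icc)
    fix t :: real
    \<comment> \<open>The antiderivative is found in a complex variable and then restricted to the
      real line. Its denominator is nonzero because \<open>n > 0\<close>, and its values at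
      \<open>0\<close> and \<open>2 * pi\<close> agree, so the integral vanishes.\<close>
    have "((\<lambda>u. exp (\<i> * n * u) / (\<i> * n)) has_field_derivative exp (\<i> * n * t))
        (at (complex_of_real t))"
      using assms by (auto intro!: derivative_eq_intros)
    from has_vector_derivative_real_field[OF this]
    show "((\<lambda>t. cis t ^ n / (\<i> * n)) has_vector_derivative cis t ^ n) (at t within {0..2*pi})"
      by (simp add: cis_conv_exp exp_of_nat_mult[symmetric] mult.assoc mult.left_commute)
  qed (auto intro!: continuous_intros)
  then show ?thesis
    by (subst integral_circle_measure) auto
qed

subsection \<open>The space \<open>L\<^sup>2\<close> of the circle\<close>

lemma circle_integrable_bounded:
  fixes F :: "complex \<Rightarrow> 'a::{banach,second_countable_topology}"
  assumes "F \<in> borel_measurable circle_measure" "AE z in circle_measure. norm (F z) \<le> C"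
  shows "integrable circle_measure F"
  using assms by (intro circle.integrable_const_bound[of _ C]) auto

lemma AE_circle_norm: "AE z in circle_measure. norm z = 1"
  by (rule AE_I2) simp

lemma circle_L2_measurable [measurable_dest]: "F \<in> circle_L2 \<Longrightarrow> F \<in> borel_measurable circle_measure"
  by (simp add: circle_L2_def)

lemma circle_Linf_measurable [measurable_dest]: "F \<in> circle_Linf \<Longrightarrow> F \<in> borel_measurable circle_measure"
  by (simp add: circle_Linf_def)

text \<open>The product is dominated by the sum of the two squares; this gives every inner product
  below an integrable integrand.\<close>

lemma circle_L2_integrable_mult:
  assumes [measurable]: "F \<in> circle_L2" "G \<in> circle_L2"
  shows "integrable circle_measure (\<lambda>z. F z * G z)"
proof (rule Bochner_Integration.integrable_bound)
  show "integrable circle_measure (\<lambda>z. (norm (F z))\<^sup>2 + (norm (G z))\<^sup>2)"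
    using assms by (auto simp: circle_L2_def)
  have "x * y \<le> x\<^sup>2 + y\<^sup>2" if "x \<ge> 0" "y \<ge> 0" for x y :: real
    using sum_squares_bound[of x y] that mult_nonneg_nonneg[OF that] by linarith
  then show "AE z in circle_measure. norm (F z * G z) \<le> norm ((norm (F z))\<^sup>2 + (norm (G z))\<^sup>2)"
    by (simp add: norm_mult)
qed measurable

lemma cnj_borel_measurable [measurable]: "cnj \<in> borel_measurable borel"
  by (intro borel_measurable_continuous_onI continuous_on_cnj continuous_on_id)

lemma circle_L2_cnj: "F \<in> circle_L2 \<Longrightarrow> (\<lambda>z. cnj (F z)) \<in> circle_L2"
  by (auto simp: circle_L2_def intro: measurable_compose[OF _ cnj_borel_measurable])

lemma circle_L2_bounded:
  assumes [measurable]: "F \<in> borel_measurable circle_measure"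
    and "AE z in circle_measure. norm (F z) \<le> C"
  shows "F \<in> circle_L2"
proof -
  have "AE z in circle_measure. norm ((norm (F z))\<^sup>2) \<le> C\<^sup>2"
    using assms(2) by eventually_elim (simp add: power_mono)
  then show ?thesis
    using circle_integrable_bounded[of "\<lambda>z. (norm (F z))\<^sup>2" "C\<^sup>2"] by (simp add: circle_L2_def)
qed

lemma circle_L2_Linf: "F \<in> circle_Linf \<Longrightarrow> F \<in> circle_L2"
  by (auto simp: circle_Linf_def intro: circle_L2_bounded)

lemma circle_L2_power: "(\<lambda>z. z ^ n) \<in> circle_L2"
  using AE_circle_norm by (intro circle_L2_bounded[of _ 1]) (auto simp: norm_power)

lemma circle_L2_Linf_mult:
  assumes [measurable]: "\<phi> \<in> circle_Linf" "F \<in> circle_L2"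
  shows "(\<lambda>z. \<phi> z * F z) \<in> circle_L2"
proof -
  obtain C where C: "AE z in circle_measure. norm (\<phi> z) \<le> C"
    using assms by (auto simp: circle_Linf_def)
  have "integrable circle_measure (\<lambda>z. (norm (\<phi> z * F z))\<^sup>2)"
  proof (rule Bochner_Integration.integrable_bound)
    show "integrable circle_measure (\<lambda>z. C\<^sup>2 * (norm (F z))\<^sup>2)"
      using assms by (auto simp: circle_L2_def)
    show "AE z in circle_measure. norm ((norm (\<phi> z * F z))\<^sup>2) \<le> norm (C\<^sup>2 * (norm (F z))\<^sup>2)"
      using C by eventually_elim (auto simp: norm_mult power_mult_distrib intro!: mult_mono power_mono)
  qed measurable
  then show ?thesis by (simp add: circle_L2_def)
qed

lemma circle_L2_cmult: "F \<in> circle_L2 \<Longrightarrow> (\<lambda>z. c * F z) \<in> circle_L2"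
  by (rule circle_L2_Linf_mult) (auto simp: circle_Linf_def)

lemma circle_L2_add:
  assumes [measurable]: "F \<in> circle_L2" "G \<in> circle_L2"
  shows "(\<lambda>z. F z + G z) \<in> circle_L2"
proof -
  have "integrable circle_measure (\<lambda>z. (norm (F z + G z))\<^sup>2)"
  proof (rule Bochner_Integration.integrable_bound)
    show "integrable circle_measure (\<lambda>z. 2 * (norm (F z))\<^sup>2 + 2 * (norm (G z))\<^sup>2)"
      using assms by (auto simp: circle_L2_def)
    have "(norm (x + y))\<^sup>2 \<le> 2 * (norm x)\<^sup>2 + 2 * (norm y)\<^sup>2" for x y :: complex
    proof -
      have "(norm (x + y))\<^sup>2 \<le> (norm x + norm y)\<^sup>2"
        by (intro power_mono norm_triangle_ineq) auto
      also have "\<dots> \<le> 2 * (norm x)\<^sup>2 + 2 * (norm y)\<^sup>2"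
        using sum_squares_bound[of "norm x" "norm y"] by (simp add: power2_sum)
      finally show ?thesis .
    qed
    then show "AE z in circle_measure. norm ((norm (F z + G z))\<^sup>2) \<le> norm (2 * (norm (F z))\<^sup>2 + 2 * (norm (G z))\<^sup>2)"
      by simp
  qed measurable
  then show ?thesis by (simp add: circle_L2_def)
qed

lemma circle_L2_diff: "F \<in> circle_L2 \<Longrightarrow> G \<in> circle_L2 \<Longrightarrow> (\<lambda>z. F z - G z) \<in> circle_L2"
  using circle_L2_add[OF _ circle_L2_cmult[of G "-1"], of F] by simp

lemma circle_L2_sum:
  "(\<And>i. i \<in> A \<Longrightarrow> F i \<in> circle_L2) \<Longrightarrow> (\<lambda>z. \<Sum>i\<in>A. F i z) \<in> circle_L2"
  by (induction A rule: infinite_finite_induct)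
     (auto intro: circle_L2_add circle_L2_bounded[of _ 0])

lemma circle_L2_poly: "(\<lambda>z. \<Sum>n\<in>A. a n * z ^ n) \<in> circle_L2"
  by (intro circle_L2_sum circle_L2_cmult circle_L2_power)

section \<open>Inner product and norm on L2 of the circle\<close>

lemma circle_inner_integrable:
  "F \<in> circle_L2 \<Longrightarrow> G \<in> circle_L2 \<Longrightarrow> integrable circle_measure (\<lambda>z. F z * cnj (G z))"
  by (intro circle_L2_integrable_mult circle_L2_cnj)

lemma circle_inner_commute: "circle_inner F G = cnj (circle_inner G F)"
proof -
  have "cnj (circle_inner G F) = (\<integral>z. cnj (G z * cnj (F z)) \<partial>circle_measure)"
    unfolding circle_inner_def by (rule Bochner_Integration.integral_cnj[symmetric])
  then show ?thesis by (simp add: circle_inner_def mult.commute)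
qed

lemma circle_inner_cmult_left: "circle_inner (\<lambda>z. c * F z) G = c * circle_inner F G"
  by (simp add: circle_inner_def mult.assoc)

lemma circle_inner_diff_left:
  "F \<in> circle_L2 \<Longrightarrow> G \<in> circle_L2 \<Longrightarrow> H \<in> circle_L2 \<Longrightarrow>
    circle_inner (\<lambda>z. F z - G z) H = circle_inner F H - circle_inner G H"
  unfolding circle_inner_def
  by (subst Bochner_Integration.integral_diff[symmetric])
     (auto simp: algebra_simps intro: circle_inner_integrable)

lemma circle_inner_diff_right:
  "F \<in> circle_L2 \<Longrightarrow> G \<in> circle_L2 \<Longrightarrow> H \<in> circle_L2 \<Longrightarrow>
    circle_inner H (\<lambda>z. F z - G z) = circle_inner H F - circle_inner H G"
  using circle_inner_diff_left[of F G H] circle_inner_commute[of H] by simp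

lemma circle_inner_sum_left:
  assumes "\<And>i. i \<in> A \<Longrightarrow> F i \<in> circle_L2" "G \<in> circle_L2"
  shows "circle_inner (\<lambda>z. \<Sum>i\<in>A. c i * F i z) G = (\<Sum>i\<in>A. c i * circle_inner (F i) G)"
proof -
  have "circle_inner (\<lambda>z. \<Sum>i\<in>A. c i * F i z) G
      = (\<integral>z. (\<Sum>i\<in>A. c i * F i z * cnj (G z)) \<partial>circle_measure)"
    by (simp add: circle_inner_def sum_distrib_right)
  also have "\<dots> = (\<Sum>i\<in>A. circle_inner (\<lambda>z. c i * F i z) G)"
    unfolding circle_inner_def
    by (intro Bochner_Integration.integral_sum circle_inner_integrable circle_L2_cmult assms)
  finally show ?thesis by (simp add: circle_inner_cmult_left)
qed

lemma circle_inner_sum_right: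
  assumes "\<And>i. i \<in> A \<Longrightarrow> F i \<in> circle_L2" "G \<in> circle_L2"
  shows "circle_inner G (\<lambda>z. \<Sum>i\<in>A. c i * F i z) = (\<Sum>i\<in>A. cnj (c i) * circle_inner G (F i))"
  by (subst (1 2) circle_inner_commute) (simp add: circle_inner_sum_left assms)

lemma circle_norm_inner: "of_real ((circle_norm F)\<^sup>2) = circle_inner F F"
proof -
  have "(\<integral>z. (norm (F z))\<^sup>2 \<partial>circle_measure) \<ge> 0" by simp
  then have "of_real ((circle_norm F)\<^sup>2) = complex_of_real (\<integral>z. (norm (F z))\<^sup>2 \<partial>circle_measure)"
    by (simp add: circle_norm_def)
  also have "\<dots> = circle_inner F F"
    unfolding circle_inner_def
    by (subst integral_complex_of_real[symmetric]) (simp only: complex_norm_square)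
  finally show ?thesis .
qed

lemma circle_norm_nonneg: "circle_norm F \<ge> 0"
  by (simp add: circle_norm_def)

lemma nn_integral_circle_norm:
  "F \<in> circle_L2 \<Longrightarrow> (\<integral>\<^sup>+z. (norm (F z))\<^sup>2 \<partial>circle_measure) = ennreal ((circle_norm F)\<^sup>2)"
  by (subst nn_integral_eq_integral) (auto simp: circle_L2_def circle_norm_def)

text \<open>Obtained from the version for nonnegative integrals. The absolute value stands inside
  the integral, so that \<open>G = 1\<close> also bounds the L1 norm by the L2 norm.\<close>

lemma circle_L2_Cauchy_Schwarz:
  assumes [measurable]: "F \<in> circle_L2" "G \<in> circle_L2"
  shows "(\<integral>z. norm (F z * G z) \<partial>circle_measure) \<le> circle_norm F * circle_norm G"
proof -
  have int: "integrable circle_measure (\<lambda>z. norm (F z * G z))"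
    using assms by (intro integrable_norm circle_L2_integrable_mult)
  have "ennreal ((\<integral>z. norm (F z * G z) \<partial>circle_measure)\<^sup>2) = (\<integral>\<^sup>+z. norm (F z) * norm (G z) \<partial>circle_measure)\<^sup>2"
    using nn_integral_eq_integral[OF int] by (simp add: norm_mult ennreal_power)
  also have "\<dots> = (\<integral>\<^sup>+z. ennreal (norm (F z)) * ennreal (norm (G z)) \<partial>circle_measure)\<^sup>2"
    by (simp add: ennreal_mult)
  also have "\<dots> \<le> (\<integral>\<^sup>+z. (ennreal (norm (F z)))\<^sup>2 \<partial>circle_measure) * (\<integral>\<^sup>+z. (ennreal (norm (G z)))\<^sup>2 \<partial>circle_measure)"
    by (rule Cauchy_Schwarz_nn_integral) measurable
  also have "\<dots> = ennreal ((circle_norm F * circle_norm G)\<^sup>2)"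
    by (simp add: ennreal_power nn_integral_circle_norm assms ennreal_mult power_mult_distrib)
  finally have "(\<integral>z. norm (F z * G z) \<partial>circle_measure)\<^sup>2 \<le> (circle_norm F * circle_norm G)\<^sup>2"
    by simp
  then show ?thesis
    by (rule power2_le_imp_le) (simp add: circle_norm_nonneg)
qed

lemma norm_circle_inner_le:
  assumes "F \<in> circle_L2" "G \<in> circle_L2"
  shows "norm (circle_inner F G) \<le> circle_norm F * circle_norm G"
proof -
  have "norm (circle_inner F G) \<le> (\<integral>z. norm (F z * cnj (G z)) \<partial>circle_measure)"
    unfolding circle_inner_def by (rule integral_norm_bound)
  also have "\<dots> \<le> circle_norm F * circle_norm (\<lambda>z. cnj (G z))"
    using assms by (intro circle_L2_Cauchy_Schwarz circle_L2_cnj)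
  finally show ?thesis by (simp add: circle_norm_def)
qed

section \<open>Orthonormality of the powers and Fourier coefficients\<close>

lemma circle_inner_power_power: "circle_inner (\<lambda>z. z ^ m) (\<lambda>z. z ^ n) = (if m = n then 1 else 0)"
proof (induction m n rule: linorder_wlog)
  case (le m n)
  \<comment> \<open>On the circle \<open>cnj z\<close> inverts \<open>z\<close>, so the integrand is
    \<open>z ^ (n - m)\<close>, whose mean is zero unless the exponent is. Conjugate symmetry of the
    inner product covers the other order of \<open>m\<close> and \<open>n\<close>.\<close>
  have "circle_inner (\<lambda>z. z ^ n) (\<lambda>z. z ^ m) = (\<integral>z. z ^ (n - m) \<partial>circle_measure)"
    unfolding circle_inner_def
  proof (rule Bochner_Integration.integral_cong)
    fix z :: complex assume "z \<in> space circle_measure"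
    then have "z ^ m * cnj z ^ m = 1"
      by (simp add: power_mult_distrib[symmetric] complex_norm_square[symmetric])
    moreover have "z ^ n = z ^ (n - m) * z ^ m"
      using le by (simp add: power_add[symmetric])
    ultimately show "z ^ n * cnj (z ^ m) = z ^ (n - m)"
      by (simp add: mult.assoc)
  qed simp
  also have "\<dots> = (if m = n then 1 else 0)"
    using le integral_circle_power[of "n - m"] by auto
  finally show ?case
    by (subst circle_inner_commute) auto
next
  case (sym m n)
  then show ?case by (subst circle_inner_commute) auto
qed

text \<open>The conjugate of \<open>cnj z ^ n\<close> is \<open>z ^ n\<close>, so the integrand is a
  positive power. This is what rules out negative frequencies in a function with a
  \<open>circle_power_series\<close>.\<close>

lemma circle_inner_cnj_power_power:
  assumes "n > 0"
  shows "circle_inner (\<lambda>z. z ^ m) (\<lambda>z. cnj z ^ n) = 0"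
proof -
  have "circle_inner (\<lambda>z. z ^ m) (\<lambda>z. cnj z ^ n) = (\<integral>z. z ^ (m + n) \<partial>circle_measure)"
    by (simp add: circle_inner_def power_add)
  then show ?thesis using integral_circle_power[of "m + n"] assms by simp
qed

lemma circle_norm_poly:
  assumes "finite A"
  shows "(circle_norm (\<lambda>z. \<Sum>n\<in>A. a n * z ^ n))\<^sup>2 = (\<Sum>n\<in>A. (norm (a n))\<^sup>2)"
proof -
  \<comment> \<open>Pythagoras: the Kronecker delta is turned back into inner products of powers, so
    that sesquilinearity alone matches the two sides.\<close>
  have "complex_of_real ((circle_norm (\<lambda>z. \<Sum>n\<in>A. a n * z ^ n))\<^sup>2)
    = (\<Sum>n\<in>A. a n * (\<Sum>m\<in>A. cnj (a m) * (if n = m then 1 else 0)))"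
    unfolding circle_norm_inner circle_inner_power_power[symmetric]
    by (subst circle_inner_sum_left, (intro circle_L2_power circle_L2_poly)+,
        subst circle_inner_sum_right) (simp_all add: circle_L2_power)
  also have "\<dots> = complex_of_real (\<Sum>n\<in>A. (norm (a n))\<^sup>2)"
    unfolding of_real_sum complex_norm_square using assms
    by (intro sum.cong) (simp_all add: if_distrib[of "\<lambda>x. _ * x"] cong: if_cong)
  finally show ?thesis by (simp only: of_real_eq_iff)
qed

text \<open>By Cauchy-Schwarz, pairing with a fixed \<open>G\<close> is continuous for L2
  convergence, so it may be applied to the series term by term.\<close>

lemma circle_power_series_inner_sums:
  assumes F: "circle_power_series a F" and G: "G \<in> circle_L2"
  shows "(\<lambda>n. a n * circle_inner (\<lambda>z. z ^ n) G) sums circle_inner F G"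
proof -
  have F2: "F \<in> circle_L2" using F by (simp add: circle_power_series_def)
  have "(\<lambda>N. circle_norm (\<lambda>z. F z - (\<Sum>n<N. a n * z ^ n)) * circle_norm G) \<longlonglongrightarrow> 0"
    using F by (intro tendsto_mult_left_zero) (simp add: circle_power_series_def)
  then have "(\<lambda>N. circle_inner (\<lambda>z. F z - (\<Sum>n<N. a n * z ^ n)) G) \<longlonglongrightarrow> 0"
    by (rule Lim_null_comparison[rotated])
       (simp add: norm_circle_inner_le F2 G circle_L2_diff circle_L2_poly)
  then have "(\<lambda>N. circle_inner F G - (\<Sum>n<N. a n * circle_inner (\<lambda>z. z ^ n) G)) \<longlonglongrightarrow> 0"
    by (simp add: circle_inner_diff_left F2 G circle_L2_poly circle_inner_sum_left circle_L2_power)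
  then have "(\<lambda>N. circle_inner F G - (circle_inner F G - (\<Sum>n<N. a n * circle_inner (\<lambda>z. z ^ n) G))) \<longlonglongrightarrow> circle_inner F G - 0"
    by (intro tendsto_intros)
  then show ?thesis by (simp add: sums_def)
qed

text \<open>Pairing the series with \<open>z ^ n\<close> leaves one term by orthonormality. Hence
  \<open>F\<close> determines its coefficients, which is how functions chosen by \<open>SOME\<close>
  are evaluated later.\<close>

lemma circle_power_series_coeff:
  assumes "circle_power_series a F"
  shows "circle_inner F (\<lambda>z. z ^ n) = a n"
proof -
  have "(\<lambda>k. a k * circle_inner (\<lambda>z. z ^ k) (\<lambda>z. z ^ n)) sums a n"
    using sums_single[of n a]
    by (simp add: circle_inner_power_power if_distrib eq_commute cong: if_cong)
  then show ?thesis
    using circle_power_series_inner_sums[OF assms circle_L2_power] sums_unique2 by blast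
qed

lemma circle_power_series_cnj_coeff:
  assumes "circle_power_series a F" "n > 0"
  shows "circle_inner F (\<lambda>z. cnj z ^ n) = 0"
proof -
  have "(\<lambda>k. a k * circle_inner (\<lambda>z. z ^ k) (\<lambda>z. cnj z ^ n)) sums circle_inner F (\<lambda>z. cnj z ^ n)"
    using circle_power_series_inner_sums[OF assms(1) circle_L2_cnj[OF circle_L2_power]]
    unfolding complex_cnj_power .
  then show ?thesis
    unfolding circle_inner_cnj_power_power[OF assms(2)] mult_zero_right
    by (rule sums_unique2) (rule sums_zero)
qed

text \<open>The squared norm of \<open>F\<close> minus its truncated Fourier sum is nonnegative, and
  this bounds all partial sums by the squared norm of \<open>F\<close>.\<close>

lemma circle_Bessel:
  assumes F: "F \<in> circle_L2"
  shows "summable (\<lambda>n. (norm (circle_inner F (\<lambda>z. z ^ n)))\<^sup>2)"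
proof (rule bounded_imp_summable)
  define a where "a n = circle_inner F (\<lambda>z. z ^ n)" for n
  fix N
  define S where "S = (\<lambda>z. \<Sum>n\<le>N. a n * z ^ n)"
  define D where "D = (\<lambda>z. F z - S z)"
  have S: "S \<in> circle_L2" and D: "D \<in> circle_L2"
    unfolding S_def D_def by (intro circle_L2_poly circle_L2_diff F)+
  \<comment> \<open>The three products of \<open>S\<close> with itself and with \<open>F\<close> are
    the same real number, so expanding \<open>circle_inner D D\<close> leaves it once, with a minus
    sign.\<close>
  have "circle_inner S S = of_real (\<Sum>n\<le>N. (norm (a n))\<^sup>2)"
    unfolding circle_norm_inner[symmetric] S_def by (subst circle_norm_poly) auto
  moreover have FS: "circle_inner F S = of_real (\<Sum>n\<le>N. (norm (a n))\<^sup>2)"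
    using F unfolding S_def of_real_sum complex_norm_square
    by (subst circle_inner_sum_right) (simp_all add: circle_L2_power mult.commute flip: a_def)
  moreover have "circle_inner S F = of_real (\<Sum>n\<le>N. (norm (a n))\<^sup>2)"
    by (subst circle_inner_commute) (simp add: FS)
  moreover have "circle_inner D D = circle_inner F F - circle_inner S F - (circle_inner F S - circle_inner S S)"
    using D by (simp add: D_def circle_inner_diff_left circle_inner_diff_right F S)
  ultimately have "complex_of_real ((circle_norm D)\<^sup>2) = of_real ((circle_norm F)\<^sup>2 - (\<Sum>n\<le>N. (norm (a n))\<^sup>2))"
    by (simp only: circle_norm_inner of_real_diff diff_self diff_zero)
  then have "(circle_norm D)\<^sup>2 = (circle_norm F)\<^sup>2 - (\<Sum>n\<le>N. (norm (a n))\<^sup>2)"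
    by (simp only: of_real_eq_iff)
  moreover have "(circle_norm D)\<^sup>2 \<ge> 0"
    by simp
  ultimately show "(\<Sum>n\<le>N. (norm (circle_inner F (\<lambda>z. z ^ n)))\<^sup>2) \<le> (circle_norm F)\<^sup>2"
    unfolding a_def by linarith
qed simp

subsection \<open>The Riesz--Fischer theorem\<close>

text \<open>By Tonelli the sum of the norms has a finite integral, hence is finite almost
  everywhere.\<close>

lemma AE_summable_norm:
  fixes f :: "nat \<Rightarrow> 'a \<Rightarrow> 'b::{banach,second_countable_topology}"
  assumes f: "\<And>i. integrable M (f i)" and sum: "summable (\<lambda>i. \<integral>x. norm (f i x) \<partial>M)"
  shows "AE x in M. summable (\<lambda>i. norm (f i x))"
proof -
  have [measurable]: "f i \<in> borel_measurable M" for i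
    using f by (rule borel_measurable_integrable)
  have "(\<integral>\<^sup>+x. (\<Sum>i. ennreal (norm (f i x))) \<partial>M) = (\<Sum>i. \<integral>\<^sup>+x. ennreal (norm (f i x)) \<partial>M)"
    by (rule nn_integral_suminf) measurable
  also have "\<dots> = (\<Sum>i. ennreal (\<integral>x. norm (f i x) \<partial>M))"
    by (simp add: nn_integral_eq_integral f)
  also have "\<dots> \<noteq> \<infinity>"
    using sum by (subst suminf_ennreal2) auto
  finally have "AE x in M. (\<Sum>i. ennreal (norm (f i x))) \<noteq> \<infinity>"
    by (intro nn_integral_PInf_AE) measurable
  then show ?thesis
    by eventually_elim (auto intro: summable_suminf_not_top)
qed

text \<open>Along a subsequence whose consecutive \<open>L\<^sup>2\<close> distances are summable, the partial sums converge
  almost everywhere; Fatou's lemma then bounds the distance of the limit from every partial sum.\<close>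

lemma circle_Riesz_Fischer:
  assumes a: "summable (\<lambda>n. (norm (a n))\<^sup>2)"
  obtains F where "circle_power_series a F"
proof -
  define S where "S N = (\<lambda>z::complex. \<Sum>n<N. a n * z ^ n)" for N
  \<comment> \<open>The tail of the series of squares; by Pythagoras it dominates the squared
    distance from \<open>S N\<close> to every later partial sum.\<close>
  define t where "t N = (\<Sum>n. (norm (a (n + N)))\<^sup>2)" for N
  have S2: "S N \<in> circle_L2" for N
    unfolding S_def by (rule circle_L2_poly)
  have norm_le: "(circle_norm (\<lambda>z. S M z - S N z))\<^sup>2 \<le> t N" if "N \<le> M" for M N
  proof -
    have "{..<M} = {..<N} \<union> {N..<M}" using that by auto
    then have "S M z - S N z = (\<Sum>n\<in>{N..<M}. a n * z ^ n)" for z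
      by (simp add: S_def sum.union_disjoint ivl_disj_int)
    then have "(circle_norm (\<lambda>z. S M z - S N z))\<^sup>2 = (\<Sum>n\<in>{N..<M}. (norm (a n))\<^sup>2)"
      by (simp add: circle_norm_poly)
    also have "\<dots> = (\<Sum>n<M - N. (norm (a (n + N)))\<^sup>2)"
      using sum.shift_bounds_nat_ivl[of "\<lambda>n. (norm (a n))\<^sup>2" 0 N "M - N"] that
      by (simp add: lessThan_atLeast0)
    also have "\<dots> \<le> t N"
      unfolding t_def using a by (intro sum_le_suminf) (auto simp: summable_iff_shift[of "\<lambda>n. (norm (a n))\<^sup>2"])
    finally show ?thesis .
  qed
  have "\<exists>N. \<forall>n\<ge>N. t n < e" if "e > 0" for e
    using suminf_exist_split[OF that a] by (auto simp: t_def abs_less_iff)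
  \<comment> \<open>Since \<open>t\<close> bounds squared distances, \<open>(1/4) ^ k\<close> here
    yields the summable distances \<open>(1/2) ^ k\<close>.\<close>
  then have "\<exists>N. \<forall>k. \<forall>n\<ge>N k. t n < (1/4) ^ k"
    by (intro choice allI) auto
  then obtain N where N: "\<And>k n. n \<ge> N k \<Longrightarrow> t n < (1/4) ^ k"
    by blast
  \<comment> \<open>Summing the indices up to \<open>N k\<close> makes \<open>r\<close>
    nondecreasing and at least \<open>N k\<close>; the summand \<open>k\<close> makes it
    unbounded.\<close>
  define r where "r k = k + (\<Sum>j\<le>k. N j)" for k :: nat
  have r_ge: "r k \<ge> N k" "r k \<ge> k" and r_Suc: "r k \<le> r (Suc k)" for k
    using member_le_sum[of k "{..k}" N] by (auto simp: r_def)
  define D where "D k = (\<lambda>z. S (r (Suc k)) z - S (r k) z)" for k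
  have D2: "D k \<in> circle_L2" for k
    unfolding D_def by (intro circle_L2_diff S2)
  \<comment> \<open>The circle has total mass one, so Cauchy-Schwarz against the constant
    \<open>1\<close> turns the L2 bounds on \<open>D k\<close> into L1 bounds.\<close>
  have one: "(\<lambda>z. 1) \<in> circle_L2" "circle_norm (\<lambda>z. 1) = 1"
    using circle_L2_power[of 0] by (simp_all add: circle_norm_def)
  have int_D: "integrable circle_measure (D k)" for k
    using circle_L2_integrable_mult[OF D2 one(1)] by simp
  have "(\<integral>z. norm (D k z) \<partial>circle_measure) \<le> (1/2) ^ k" for k
  proof -
    have "(circle_norm (D k))\<^sup>2 \<le> (1/4) ^ k"
      using norm_le[OF r_Suc[of k]] N[OF r_ge(1)[of k]] by (simp add: D_def)
    also have "\<dots> = ((1/2) ^ k)\<^sup>2"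
      by (simp add: power2_eq_square flip: power_mult_distrib)
    finally have "circle_norm (D k) \<le> (1/2) ^ k"
      by (rule power2_le_imp_le) simp
    then show ?thesis
      using circle_L2_Cauchy_Schwarz[OF D2 one(1), of k] by (simp add: one(2))
  qed
  then have "summable (\<lambda>k. \<integral>z. norm (D k z) \<partial>circle_measure)"
    by (intro summable_comparison_test'[OF summable_geometric[of "1/2::real"]]) auto
  then have "AE z in circle_measure. summable (\<lambda>k. norm (D k z))"
    by (rule AE_summable_norm[OF int_D])
  \<comment> \<open>Using \<open>lim\<close> gives a measurable function outright; its unspecified
    values where the sequence diverges lie on a null set.\<close>
  define U where "U = (\<lambda>z. lim (\<lambda>k. S (r k) z))"
  have U [measurable]: "U \<in> borel_measurable circle_measure"
    unfolding U_def using S2 by measurable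
  have lim: "AE z in circle_measure. (\<lambda>k. S (r k) z) \<longlonglongrightarrow> U z"
    using \<open>AE z in circle_measure. summable (\<lambda>k. norm (D k z))\<close>
  proof eventually_elim
    fix z assume "summable (\<lambda>k. norm (D k z))"
    then have "summable (\<lambda>k. D k z)" by (rule summable_norm_cancel)
    then have "(\<lambda>K. (\<Sum>k<K. D k z) + S (r 0) z) \<longlonglongrightarrow> (\<Sum>k. D k z) + S (r 0) z"
      by (intro tendsto_add tendsto_const summable_LIMSEQ)
    then have "(\<lambda>K. S (r K) z) \<longlonglongrightarrow> (\<Sum>k. D k z) + S (r 0) z"
      by (simp add: D_def sum_lessThan_telescope[of "\<lambda>k. S (r k) z"])
    then show "(\<lambda>k. S (r k) z) \<longlonglongrightarrow> U z"
      unfolding U_def by (subst limI) assumption+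
  qed
  have t_nonneg: "t M \<ge> 0" for M
    by (rule order_trans[OF zero_le_power2 norm_le[OF order_refl]])
  have bound: "(\<integral>\<^sup>+z. ennreal ((norm (U z - S M z))\<^sup>2) \<partial>circle_measure) \<le> ennreal (t M)" for M
  proof -
    have [measurable]: "S k \<in> borel_measurable circle_measure" for k
      using S2 by measurable
    have "(\<integral>\<^sup>+z. ennreal ((norm (U z - S M z))\<^sup>2) \<partial>circle_measure)
      = (\<integral>\<^sup>+z. liminf (\<lambda>k. ennreal ((norm (S (r k) z - S M z))\<^sup>2)) \<partial>circle_measure)"
    proof (rule nn_integral_cong_AE)
      show "AE z in circle_measure. ennreal ((norm (U z - S M z))\<^sup>2)
          = liminf (\<lambda>k. ennreal ((norm (S (r k) z - S M z))\<^sup>2))"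
        using lim
        by eventually_elim (intro lim_imp_Liminf[symmetric] tendsto_intros; simp)
    qed
    also have "\<dots> \<le> liminf (\<lambda>k. \<integral>\<^sup>+z. ennreal ((norm (S (r k) z - S M z))\<^sup>2) \<partial>circle_measure)"
      by (rule nn_integral_liminf) measurable
    also have "\<dots> \<le> ennreal (t M)"
    proof (rule Liminf_le)
      show "\<forall>\<^sub>F k in sequentially. (\<integral>\<^sup>+z. ennreal ((norm (S (r k) z - S M z))\<^sup>2) \<partial>circle_measure) \<le> ennreal (t M)"
        using eventually_ge_at_top[of M]
      proof eventually_elim
        fix k assume "M \<le> k"
        then have "M \<le> r k" using r_ge(2)[of k] by linarith
        then show "(\<integral>\<^sup>+z. ennreal ((norm (S (r k) z - S M z))\<^sup>2) \<partial>circle_measure) \<le> ennreal (t M)"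
          using norm_le by (simp add: nn_integral_circle_norm circle_L2_diff S2 ennreal_leI)
      qed
    qed simp
    finally show ?thesis .
  qed
  \<comment> \<open>The partial sum \<open>S 0\<close> is zero, so the bound at \<open>M = 0\<close>
    is one on \<open>U\<close> itself.\<close>
  have "integrable circle_measure (\<lambda>z. (norm (U z))\<^sup>2)"
    using bound[of 0] by (intro integrableI_bounded) (auto simp: S_def intro: le_less_trans)
  then have U2: "U \<in> circle_L2"
    by (simp add: circle_L2_def)
  have "circle_norm (\<lambda>z. U z - S M z) \<le> sqrt (t M)" for M
  proof -
    have "(\<lambda>z. U z - S M z) \<in> circle_L2"
      by (intro circle_L2_diff U2 S2)
    then have "(circle_norm (\<lambda>z. U z - S M z))\<^sup>2 \<le> t M"
      using bound[of M] t_nonneg[of M] by (simp add: nn_integral_circle_norm)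
    then show ?thesis by (rule real_le_rsqrt)
  qed
  then have le: "\<forall>\<^sub>F M in sequentially. circle_norm (\<lambda>z. U z - S M z) \<le> sqrt (t M)"
    by (intro always_eventually allI)
  have ge: "\<forall>\<^sub>F M in sequentially. 0 \<le> circle_norm (\<lambda>z. U z - S M z)"
    by (intro always_eventually allI circle_norm_nonneg)
  have "t \<longlonglongrightarrow> 0"
    unfolding t_def using a by (rule suminf_exist_split2)
  then have "(\<lambda>M. sqrt (t M)) \<longlonglongrightarrow> 0"
    using tendsto_real_sqrt by force
  from real_tendsto_sandwich[OF ge le tendsto_const this]
  have "(\<lambda>M. circle_norm (\<lambda>z. U z - S M z)) \<longlonglongrightarrow> 0" .
  then have "circle_power_series a U"
    using U2 by (simp add: circle_power_series_def S_def)
  then show ?thesis by (rule that)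
qed

subsection \<open>Completeness of the Fourier system\<close>

text \<open>Integrable functions with vanishing Fourier coefficients: \<open>cnj z\<close> is the
  inverse of \<open>z\<close> on the circle, so the two families cover the frequencies of both
  signs. Completeness means that such a function is zero almost everywhere. The test functions are
  widened in turn to real polynomials, continuous functions, and indicators of closed and then Borel
  sets.\<close>

definition circle_annihilator :: "(complex \<Rightarrow> complex) set" where
  "circle_annihilator = {F. integrable circle_measure F \<and>
     (\<forall>n. (\<integral>z. z ^ n * F z \<partial>circle_measure) = 0) \<and> (\<forall>n. (\<integral>z. cnj z ^ n * F z \<partial>circle_measure) = 0)}"

lemma circle_integrable_mult_bounded:
  assumes [measurable]: "h \<in> borel_measurable circle_measure"
    and F: "integrable circle_measure F" and h: "\<And>z. norm z = 1 \<Longrightarrow> norm (h z) \<le> C"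
  shows "integrable circle_measure (\<lambda>z. h z * F z :: complex)"
proof (rule Bochner_Integration.integrable_bound)
  show "integrable circle_measure (\<lambda>z. C * norm (F z))"
    using F by auto
  have [measurable]: "F \<in> borel_measurable circle_measure"
    using F by auto
  show "(\<lambda>z. h z * F z) \<in> borel_measurable circle_measure"
    by measurable
  show "AE z in circle_measure. norm (h z * F z) \<le> norm (C * norm (F z))"
    using AE_circle_norm
  proof eventually_elim
    fix z :: complex assume "norm z = 1"
    then have "norm (h z) \<le> \<bar>C\<bar>" using h[of z] by linarith
    then show "norm (h z * F z) \<le> norm (C * norm (F z))"
      by (simp add: norm_mult abs_mult mult_right_mono)
  qed
qed

lemma circle_integral_cong:
  "(\<And>z. norm z = 1 \<Longrightarrow> F z = G z) \<Longrightarrow> (\<integral>z. F z \<partial>circle_measure) = (\<integral>z. G z \<partial>circle_measure)"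
  by (rule Bochner_Integration.integral_cong) auto

text \<open>Conjugation exchanges the two families of conditions, so multiplication by
  \<open>cnj z\<close> can be reduced to multiplication by \<open>z\<close>.\<close>

lemma circle_annihilator_cnj:
  assumes "F \<in> circle_annihilator"
  shows "(\<lambda>z. cnj (F z)) \<in> circle_annihilator"
proof -
  have "(\<integral>z. z ^ n * cnj (F z) \<partial>circle_measure) = cnj (\<integral>z. cnj z ^ n * F z \<partial>circle_measure)"
    "(\<integral>z. cnj z ^ n * cnj (F z) \<partial>circle_measure) = cnj (\<integral>z. z ^ n * F z \<partial>circle_measure)" for n
    by (simp_all flip: Bochner_Integration.integral_cnj)
  then show ?thesis using assms by (simp add: circle_annihilator_def)
qed

lemma circle_annihilator_mult_id:
  assumes F: "F \<in> circle_annihilator"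
  shows "(\<lambda>z. z * F z) \<in> circle_annihilator"
proof -
  have "(\<integral>z. z ^ n * (z * F z) \<partial>circle_measure) = 0" for n
  proof -
    have "(\<integral>z. z ^ Suc n * F z \<partial>circle_measure) = 0"
      using F unfolding circle_annihilator_def by blast
    then show ?thesis unfolding power_Suc2 mult.assoc .
  qed
  moreover have "(\<integral>z. cnj z ^ n * (z * F z) \<partial>circle_measure) = 0" for n
  \<comment> \<open>Multiplication by \<open>z\<close> shifts frequencies by one. At
    \<open>n = 0\<close> the shift leads into the first family, at exponent 1; otherwise
    \<open>z\<close> cancels one factor \<open>cnj z\<close>.\<close>
  proof (cases n)
    case 0
    then show ?thesis using F[unfolded circle_annihilator_def] by (auto dest: spec[of _ 1])
  next
    case (Suc m)
    have "(\<integral>z. cnj z ^ n * (z * F z) \<partial>circle_measure) = (\<integral>z. cnj z ^ m * F z \<partial>circle_measure)"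
    proof (rule circle_integral_cong)
      fix z :: complex assume "norm z = 1"
      then have "z * cnj z = 1" by (simp add: complex_norm_square[symmetric])
      then show "cnj z ^ n * (z * F z) = cnj z ^ m * F z"
        by (simp add: Suc) (metis mult.assoc mult.commute mult.left_neutral)
    qed
    then show ?thesis using F by (simp add: circle_annihilator_def)
  qed
  moreover have "integrable circle_measure (\<lambda>z. z * F z)"
    using F by (intro circle_integrable_mult_bounded[of _ _ 1]) (auto simp: circle_annihilator_def)
  ultimately show ?thesis by (simp add: circle_annihilator_def)
qed

lemma circle_annihilator_mult_cnj:
  assumes "F \<in> circle_annihilator"
  shows "(\<lambda>z. cnj z * F z) \<in> circle_annihilator"
  using circle_annihilator_cnj[OF circle_annihilator_mult_id[OF circle_annihilator_cnj[OF assms]]] by simp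

lemma circle_annihilator_cmult:
  "F \<in> circle_annihilator \<Longrightarrow> (\<lambda>z. c * F z) \<in> circle_annihilator"
  by (simp add: circle_annihilator_def mult.left_commute[of _ c])

lemma circle_annihilator_add:
  assumes "F \<in> circle_annihilator" "G \<in> circle_annihilator"
  shows "(\<lambda>z. F z + G z) \<in> circle_annihilator"
proof -
  have "integrable circle_measure (\<lambda>z. z ^ n * H z)" "integrable circle_measure (\<lambda>z. cnj z ^ n * H z)"
    if "H \<in> circle_annihilator" for H n
    using that by (auto intro!: circle_integrable_mult_bounded[of _ _ 1] simp: norm_power circle_annihilator_def)
  then show ?thesis
    using assms by (simp add: circle_annihilator_def distrib_left)
qed

text \<open>The annihilator of the trigonometric polynomials is a module over them, so no explicit
  expansion of a polynomial in \<open>Re z\<close> and \<open>Im z\<close> is needed.\<close>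

lemma circle_annihilator_mult_polynomial:
  assumes "real_polynomial_function p" "F \<in> circle_annihilator"
  shows "(\<lambda>z. of_real (p z) * F z) \<in> circle_annihilator"
  using assms
proof (induction p arbitrary: F rule: real_polynomial_function.induct)
  case (linear f)
  interpret bounded_linear f by fact
  \<comment> \<open>A real-linear functional on the plane is
    \<open>Re z * f 1 + Im z * f \<i>\<close>; writing \<open>Re z\<close> and \<open>Im z\<close>
    through \<open>z\<close> and \<open>cnj z\<close> gives these coefficients.\<close>
  define c d where "c = (of_real (f 1) - \<i> * of_real (f \<i>)) / 2" and "d = (of_real (f 1) + \<i> * of_real (f \<i>)) / 2"
  have "of_real (f z) = c * z + d * cnj z" for z
  proof -
    have "f z = f (Re z *\<^sub>R 1 + Im z *\<^sub>R \<i>)"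
      by (rule arg_cong[of _ _ f]) (simp add: complex_eq_iff)
    then have "f z = Re z * f 1 + Im z * f \<i>"
      by (simp only: add scale real_scaleR_def)
    then show ?thesis
      by (simp add: complex_eq_iff c_def d_def field_simps)
  qed
  then have "(\<lambda>z. of_real (f z) * F z) = (\<lambda>z. c * (z * F z) + d * (cnj z * F z))"
    by (simp add: algebra_simps)
  then show ?case
    using linear.prems by (simp add: circle_annihilator_add circle_annihilator_cmult
        circle_annihilator_mult_id circle_annihilator_mult_cnj)
next
  case (const c)
  then show ?case by (rule circle_annihilator_cmult)
next
  case (add f g)
  then show ?case by (simp add: distrib_right circle_annihilator_add)
next
  case (mult f g)
  then show ?case by (simp add: mult.assoc)
qed

text \<open>Stone-Weierstrass approximates \<open>h\<close> uniformly on the circle by polynomials,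
  whose integrals against \<open>F\<close> vanish; the error is at most the uniform distance times
  the L1 norm of \<open>F\<close>.\<close>

lemma circle_annihilator_continuous:
  fixes h :: "complex \<Rightarrow> real"
  assumes F: "F \<in> circle_annihilator" and h: "continuous_on UNIV h"
  shows "(\<integral>z. of_real (h z) * F z \<partial>circle_measure) = 0"
proof -
  have F1: "integrable circle_measure F" using F by (simp add: circle_annihilator_def)
  define C where "C = (\<integral>z. norm (F z) \<partial>circle_measure)"
  have "C \<ge> 0" by (simp add: C_def)
  have "norm (\<integral>z. of_real (h z) * F z \<partial>circle_measure) \<le> 0 + e" if "e > 0" for e
  proof -
    \<comment> \<open>The denominator is \<open>C + 1\<close> rather than \<open>C\<close> because
      the L1 norm \<open>C\<close> may be zero.\<close>
    define e' where "e' = e / (C + 1)"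
    have "e' > 0" using \<open>C \<ge> 0\<close> that by (simp add: e'_def)
    from Stone_Weierstrass_real_polynomial_function[OF compact_sphere continuous_on_subset[OF h subset_UNIV] this]
    obtain p where p: "real_polynomial_function p" "\<And>z. z \<in> sphere 0 1 \<Longrightarrow> \<bar>h z - p z\<bar> < e'"
      by metis
    have "continuous_on UNIV p"
      using p(1) continuous_on_polymonial_function by (auto simp: real_polynomial_function_eq)
    then have cont: "continuous_on UNIV (\<lambda>z. complex_of_real (h z - p z))"
      by (intro continuous_intros h)
    have meas: "(\<lambda>z. complex_of_real (h z - p z)) \<in> borel_measurable circle_measure"
      by (intro borel_measurable_circle_measure borel_measurable_continuous_onI cont)
    have pF: "(\<lambda>z. of_real (p z) * F z) \<in> circle_annihilator"
      by (rule circle_annihilator_mult_polynomial[OF p(1) F])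
    then have ip: "integrable circle_measure (\<lambda>z. of_real (p z) * F z)"
      and zp: "(\<integral>z. of_real (p z) * F z \<partial>circle_measure) = 0"
      by (auto simp: circle_annihilator_def dest: spec[of _ 0])
    have le: "norm (complex_of_real (h z - p z)) \<le> e'" if "norm z = 1" for z
      using p(2)[of z] that by (simp del: of_real_diff)
    have id: "integrable circle_measure (\<lambda>z. of_real (h z - p z) * F z)"
      by (rule circle_integrable_mult_bounded[OF meas F1 le])
    have "(\<integral>z. of_real (h z) * F z \<partial>circle_measure)
        = (\<integral>z. of_real (h z - p z) * F z + of_real (p z) * F z \<partial>circle_measure)"
      by (simp add: algebra_simps)
    also have "\<dots> = (\<integral>z. of_real (h z - p z) * F z \<partial>circle_measure)"
      by (simp only: Bochner_Integration.integral_add[OF id ip] zp add_0_right)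
    also have "norm \<dots> \<le> (\<integral>z. e' * norm (F z) \<partial>circle_measure)"
    proof (rule Bochner_Integration.integral_norm_bound_integral[OF id])
      show "integrable circle_measure (\<lambda>z. e' * norm (F z))" using F1 by auto
      show "norm (complex_of_real (h z - p z) * F z) \<le> e' * norm (F z)" if "z \<in> space circle_measure" for z
        using le[of z] that unfolding norm_mult by (intro mult_right_mono) auto
    qed
    also have "\<dots> = e' * C" by (simp add: C_def)
    also have "\<dots> \<le> e" using that \<open>C \<ge> 0\<close> by (simp add: e'_def field_simps)
    finally show ?thesis by simp
  qed
  then have "norm (\<integral>z. of_real (h z) * F z \<partial>circle_measure) \<le> 0"
    by (rule field_le_epsilon)
  then show ?thesis by simp
qed

text \<open>Continuous cutoffs converge pointwise to the indicator, and \<open>norm (F z)\<close>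
  dominates the integrands.\<close>

lemma circle_annihilator_closed:
  assumes F: "F \<in> circle_annihilator" and A: "closed A"
  shows "(\<integral>z. indicator A z *\<^sub>R F z \<partial>circle_measure) = 0"
proof (cases "A = {}")
  case False
  have F1: "integrable circle_measure F" using F by (simp add: circle_annihilator_def)
  then have [measurable]: "F \<in> borel_measurable circle_measure" by auto
  \<comment> \<open>The cutoffs decrease to the indicator of \<open>A\<close> because
    \<open>A\<close> is closed. The empty set is treated apart: \<open>infdist\<close> to it is 0 by
    convention, which would make every \<open>h k\<close> constantly 1.\<close>
  define h where "h k z = max 0 (1 - real k * infdist z A)" for k z
  have cont: "continuous_on UNIV (h k)" for k
    unfolding h_def by (intro continuous_intros)
  have [measurable]: "h k \<in> borel_measurable circle_measure" for k
    by (intro borel_measurable_circle_measure borel_measurable_continuous_onI cont)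
  have [measurable]: "indicat_real A \<in> borel_measurable circle_measure"
    using A by (intro borel_measurable_circle_measure) auto
  have "(\<lambda>k. \<integral>z. of_real (h k z) * F z \<partial>circle_measure) \<longlonglongrightarrow> (\<integral>z. indicator A z *\<^sub>R F z \<partial>circle_measure)"
  proof (rule integral_dominated_convergence[where w="\<lambda>z. norm (F z)"])
    show "integrable circle_measure (\<lambda>z. norm (F z))" using F1 by auto
    show "AE z in circle_measure. norm (of_real (h k z) * F z) \<le> norm (F z)" for k
      by (intro AE_I2) (auto simp: norm_mult h_def infdist_nonneg intro!: mult_left_le_one_le)
    have "(\<lambda>k. h k z) \<longlonglongrightarrow> indicator A z" for z
    proof (cases "z \<in> A")
      case True
      then show ?thesis by (simp add: h_def)
    next
      case notin: False
      then have pos: "infdist z A > 0"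
        using A False by (intro infdist_pos_not_in_closed)
      obtain K :: nat where K: "K * infdist z A > 1"
        using ex_less_of_nat_mult[OF pos] by blast
      have "\<forall>\<^sub>F k in sequentially. h k z = 0"
        using eventually_ge_at_top[of K]
      proof eventually_elim
        fix k assume "K \<le> k"
        then have "K * infdist z A \<le> k * infdist z A"
          using pos by (intro mult_right_mono) auto
        then show "h k z = 0" using K by (simp add: h_def)
      qed
      then show ?thesis using notin by (simp add: tendsto_eventually)
    qed
    then show "AE z in circle_measure. (\<lambda>k. of_real (h k z) * F z) \<longlonglongrightarrow> indicator A z *\<^sub>R F z"
      unfolding scaleR_conv_of_real by (intro AE_I2 tendsto_intros)
  qed measurable
  then have "(\<lambda>k. 0) \<longlonglongrightarrow> (\<integral>z. indicator A z *\<^sub>R F z \<partial>circle_measure)"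
    by (simp add: circle_annihilator_continuous[OF F cont])
  then show ?thesis using LIMSEQ_unique tendsto_const by blast
qed simp

text \<open>Dynkin's argument: closed sets are stable under intersection and generate the Borel
  sets, and vanishing of the integral passes to complements and countable disjoint unions.\<close>

lemma circle_annihilator_borel:
  assumes F: "F \<in> circle_annihilator" and A: "A \<in> sets borel"
  shows "(\<integral>z. indicator A z *\<^sub>R F z \<partial>circle_measure) = 0"
proof -
  have F1: "integrable circle_measure F" using F by (simp add: circle_annihilator_def)
  have int: "integrable circle_measure (\<lambda>z. indicator B z *\<^sub>R F z)" if "B \<in> sets borel" for B
  proof -
    have "(\<lambda>z. complex_of_real (indicator B z)) \<in> borel_measurable circle_measure"
      using that by (intro borel_measurable_circle_measure) simp
    then show ?thesis
      unfolding scaleR_conv_of_real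
      by (rule circle_integrable_mult_bounded[OF _ F1, of _ 1]) (simp add: indicator_def)
  qed
  have borel: "sets borel = sigma_sets UNIV (Collect closed :: complex set set)"
    unfolding borel_eq_closed by (rule sets_measure_of) simp
  have "Int_stable (Collect closed :: complex set set)" "Collect closed \<subseteq> Pow (UNIV :: complex set)"
    by (auto simp: Int_stable_def)
  then show ?thesis
    using A[unfolded borel]
  proof (induction rule: sigma_sets_induct_disjoint)
    case (basic A)
    then show ?case using circle_annihilator_closed[OF F] by simp
  next
    case empty
    show ?case by simp
  next
    case (compl A)
    \<comment> \<open>The whole plane is closed, so the integral of \<open>F\<close> itself
      vanishes.\<close>
    have "(\<integral>z. indicator (UNIV - A) z *\<^sub>R F z \<partial>circle_measure)
      = (\<integral>z. F z - indicator A z *\<^sub>R F z \<partial>circle_measure)"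
      by (rule Bochner_Integration.integral_cong) (auto simp: indicator_def)
    also have "\<dots> = (\<integral>z. indicator UNIV z *\<^sub>R F z \<partial>circle_measure)"
      using F1 int[of A] compl by (simp add: borel)
    finally show ?case using circle_annihilator_closed[OF F, of UNIV] by simp
  next
    case (union A)
    \<comment> \<open>Dominated convergence reduces the countable union to finite ones, where
      disjointness splits the indicator into a sum.\<close>
    have "(\<lambda>n. \<integral>z. indicator (\<Union>i<n. A i) z *\<^sub>R F z \<partial>circle_measure) \<longlonglongrightarrow> (\<integral>z. indicator (\<Union>i. A i) z *\<^sub>R F z \<partial>circle_measure)"
    proof (rule integral_dominated_convergence[where w="\<lambda>z. norm (F z)"])
      show "integrable circle_measure (\<lambda>z. norm (F z))" using F1 by auto
      show "(\<lambda>z. indicator (\<Union>i. A i) z *\<^sub>R F z) \<in> borel_measurable circle_measure"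
        "\<And>n. (\<lambda>z. indicator (\<Union>i<n. A i) z *\<^sub>R F z) \<in> borel_measurable circle_measure"
        using union by (intro borel_measurable_integrable[OF int] sets.countable_UN sets.finite_UN; auto simp: borel)+
      show "AE z in circle_measure. (\<lambda>n. indicator (\<Union>i<n. A i) z *\<^sub>R F z) \<longlonglongrightarrow> indicator (\<Union>i. A i) z *\<^sub>R F z"
        by (intro AE_I2 tendsto_intros LIMSEQ_indicator_UN)
    qed (auto simp: indicator_def)
    moreover have "(\<integral>z. indicator (\<Union>i<n. A i) z *\<^sub>R F z \<partial>circle_measure) = 0" for n
    proof -
      have "(\<integral>z. indicator (\<Union>i<n. A i) z *\<^sub>R F z \<partial>circle_measure)
         = (\<integral>z. (\<Sum>i<n. indicator (A i) z *\<^sub>R F z) \<partial>circle_measure)"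
        using union(1)
        by (subst indicator_UN_disjoint) (auto simp: scaleR_sum_left disjoint_family_on_def)
      also have "\<dots> = (\<Sum>i<n. \<integral>z. indicator (A i) z *\<^sub>R F z \<partial>circle_measure)"
        using union(2) by (intro Bochner_Integration.integral_sum int) (auto simp: borel)
      finally show ?thesis using union(3) by simp
    qed
    ultimately show ?case by (simp add: LIMSEQ_const_iff)
  qed
qed

text \<open>A function whose integral over every measurable set is zero vanishes almost everywhere;
  the measurable sets of the circle are traces of Borel sets of the plane.\<close>

lemma circle_annihilator_AE_zero:
  assumes F: "F \<in> circle_annihilator"
  shows "AE z in circle_measure. F z = 0"
proof (rule circle.density_zero)
  show "integrable circle_measure F" using F by (simp add: circle_annihilator_def)
  fix A assume "A \<in> sets circle_measure"
  then obtain B where B: "B \<in> sets borel" "A = sphere 0 1 \<inter> B"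
    unfolding sets_circle_measure sets_restrict_space by auto
  have "set_lebesgue_integral circle_measure A F = (\<integral>z. indicator B z *\<^sub>R F z \<partial>circle_measure)"
    unfolding set_lebesgue_integral_def B(2)
    by (rule Bochner_Integration.integral_cong) (auto simp: indicator_def)
  then show "set_lebesgue_integral circle_measure A F = 0"
    using circle_annihilator_borel[OF F B(1)] by simp
qed

subsection \<open>Projections and the two Hardy spaces\<close>

lemma hardy_circle_L2: "F \<in> hardy_circle \<Longrightarrow> F \<in> circle_L2"
  by (auto simp: hardy_circle_def circle_power_series_def)

lemma hardy_circle_power: "(\<lambda>z. z ^ n) \<in> hardy_circle"
proof -
  define a :: "nat \<Rightarrow> complex" where "a k = (if k = n then 1 else 0)" for k
  have "(\<Sum>k<N. a k * z ^ k) = z ^ n" if "N > n" for N and z :: complex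
    using that by (simp add: a_def if_distrib[of "\<lambda>x. x * _"] cong: if_cong)
  then have "\<forall>\<^sub>F N in sequentially. circle_norm (\<lambda>z. z ^ n - (\<Sum>k<N. a k * z ^ k)) = 0"
    by (intro eventually_mono[OF eventually_gt_at_top[of n]]) (simp add: circle_norm_def)
  then have "circle_power_series a (\<lambda>z. z ^ n)"
    by (simp add: circle_power_series_def circle_L2_power tendsto_eventually)
  moreover have "summable (\<lambda>k. (norm (a k))\<^sup>2)"
    by (rule summable_finite[of "{n}"]) (auto simp: a_def)
  ultimately show ?thesis
    by (auto simp: hardy_circle_def)
qed

text \<open>Existence of a projection makes the choice in \<open>P_plus\<close> meaningful. The
  Fourier coefficients of nonnegative index are square-summable by Bessel and realized by
  Riesz-Fischer; the remainder is orthogonal to all powers, hence to every L2 limit of their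
  combinations.\<close>

lemma P_plus_projection:
  assumes F: "F \<in> circle_L2"
  shows "P_plus F \<in> hardy_circle \<and> (\<forall>V\<in>hardy_circle. circle_inner (\<lambda>z. F z - P_plus F z) V = 0)"
proof -
  define a where "a n = circle_inner F (\<lambda>z. z ^ n)" for n
  have a: "summable (\<lambda>n. (norm (a n))\<^sup>2)"
    unfolding a_def by (rule circle_Bessel[OF F])
  then obtain U where U: "circle_power_series a U"
    by (rule circle_Riesz_Fischer)
  then have U2: "U \<in> circle_L2" by (simp add: circle_power_series_def)
  define D where "D = (\<lambda>z. F z - U z)"
  have D: "D \<in> circle_L2" unfolding D_def by (rule circle_L2_diff[OF F U2])
  have "circle_inner D (\<lambda>z. z ^ n) = 0" for n
    unfolding D_def circle_inner_diff_left[OF F U2 circle_L2_power] circle_power_series_coeff[OF U] a_def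
    by simp
  then have z: "circle_inner (\<lambda>z. z ^ n) D = 0" for n
    by (subst circle_inner_commute) simp
  have "circle_inner D V = 0" if V: "V \<in> hardy_circle" for V
  proof -
    obtain b where "circle_power_series b V"
      using V by (auto simp: hardy_circle_def)
    from circle_power_series_inner_sums[OF this D] have "circle_inner V D = 0"
      unfolding z mult_zero_right by (rule sums_unique2) (rule sums_zero)
    then show ?thesis by (subst circle_inner_commute) simp
  qed
  then have "\<exists>U. U \<in> hardy_circle \<and> (\<forall>V\<in>hardy_circle. circle_inner (\<lambda>z. F z - U z) V = 0)"
    using U a by (auto simp: hardy_circle_def D_def)
  from someI_ex[OF this] show ?thesis
    unfolding P_plus_def .
qed

lemma P_plus_hardy: "F \<in> circle_L2 \<Longrightarrow> P_plus F \<in> hardy_circle"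
  using P_plus_projection by blast

lemma P_minus_L2: "F \<in> circle_L2 \<Longrightarrow> P_minus F \<in> circle_L2"
  unfolding P_minus_def by (rule circle_L2_diff[OF _ hardy_circle_L2[OF P_plus_hardy]])

lemma P_minus_coeff:
  assumes "F \<in> circle_L2"
  shows "circle_inner (P_minus F) (\<lambda>z. z ^ n) = 0"
  unfolding P_minus_def using P_plus_projection[OF assms] hardy_circle_power by blast

lemma P_plus_coeff:
  assumes F: "F \<in> circle_L2"
  shows "circle_inner (P_plus F) (\<lambda>z. z ^ n) = circle_inner F (\<lambda>z. z ^ n)"
  using P_minus_coeff[OF F, of n]
    circle_inner_diff_left[OF F hardy_circle_L2[OF P_plus_hardy[OF F]] circle_L2_power]
  by (simp add: P_minus_def)

text \<open>The conjugate \<open>G\<close> of \<open>P_minus F\<close> has only positive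
  frequencies. Its coefficients define a Hardy function \<open>U\<close>, and all Fourier
  coefficients of \<open>G - U\<close> vanish, so completeness gives \<open>G = U\<close> almost
  everywhere.\<close>

lemma cnj_P_minus_hardy:
  assumes F: "F \<in> circle_L2"
  shows "(\<lambda>z. cnj (P_minus F z)) \<in> hardy_circle"
proof -
  define G where "G = (\<lambda>z. cnj (P_minus F z))"
  have G: "G \<in> circle_L2"
    unfolding G_def by (intro circle_L2_cnj P_minus_L2 F)
  define b where "b n = circle_inner G (\<lambda>z. z ^ n)" for n
  have b: "summable (\<lambda>n. (norm (b n))\<^sup>2)"
    unfolding b_def by (rule circle_Bessel[OF G])
  then obtain U where U: "circle_power_series b U"
    by (rule circle_Riesz_Fischer)
  then have U2: "U \<in> circle_L2" by (simp add: circle_power_series_def)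
  define D where "D = (\<lambda>z. G z - U z)"
  have D: "D \<in> circle_L2" unfolding D_def by (rule circle_L2_diff[OF G U2])
  have D1: "circle_inner D (\<lambda>z. z ^ n) = 0" for n
    unfolding D_def circle_inner_diff_left[OF G U2 circle_L2_power] circle_power_series_coeff[OF U] b_def
    by simp
  \<comment> \<open>For \<open>n = 0\<close> this is the constant function, already covered by
    \<open>D1\<close>. For \<open>n > 0\<close> the coefficients of \<open>G\<close> and
    \<open>U\<close> are zero separately.\<close>
  have D2: "circle_inner D (\<lambda>z. cnj z ^ n) = 0" for n
  proof (cases "n = 0")
    case True
    then show ?thesis using D1[of 0] by simp
  next
    case False
    have "circle_inner G (\<lambda>z. cnj z ^ n) = (\<integral>z. cnj (P_minus F z * cnj (z ^ n)) \<partial>circle_measure)"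
      by (simp add: circle_inner_def G_def)
    also have "\<dots> = cnj (circle_inner (P_minus F) (\<lambda>z. z ^ n))"
      unfolding circle_inner_def by (rule Bochner_Integration.integral_cnj)
    finally have "circle_inner G (\<lambda>z. cnj z ^ n) = 0"
      using P_minus_coeff[OF F] by simp
    moreover have "(\<lambda>z. cnj z ^ n) \<in> circle_L2"
      using circle_L2_cnj[OF circle_L2_power[of n]] by simp
    ultimately show ?thesis
      using circle_power_series_cnj_coeff[OF U, of n] False
      by (simp add: D_def circle_inner_diff_left G U2)
  qed
  have "integrable circle_measure D"
    using circle_L2_integrable_mult[OF D circle_L2_power[of 0]] by simp
  then have "D \<in> circle_annihilator"
    using D1 D2 by (simp add: circle_annihilator_def circle_inner_def mult.commute)
  then have "AE z in circle_measure. D z = 0"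
    by (rule circle_annihilator_AE_zero)
  then have AE: "AE z in circle_measure. G z = U z"
    by (simp add: D_def)
  \<comment> \<open>The L2 distances do not see null sets, so the power series of \<open>U\<close>
    also represents \<open>G\<close>.\<close>
  have "circle_norm (\<lambda>z. G z - (\<Sum>n<N. b n * z ^ n)) = circle_norm (\<lambda>z. U z - (\<Sum>n<N. b n * z ^ n))" for N
  proof -
    have [measurable]: "G \<in> borel_measurable circle_measure" "U \<in> borel_measurable circle_measure"
      "(\<lambda>z. \<Sum>n<N. b n * z ^ n) \<in> borel_measurable circle_measure"
      using G U2 circle_L2_poly[of b "{..<N}"] by (simp_all only: circle_L2_measurable)
    show ?thesis
      unfolding circle_norm_def using AE
      by (intro arg_cong[where f=sqrt] integral_cong_AE) (measurable, auto elim!: eventually_mono)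
  qed
  then have "circle_power_series b G"
    using U G by (simp add: circle_power_series_def)
  then show ?thesis
    using b by (auto simp: hardy_circle_def G_def)
qed

section \<open>Passage from the circle to the disc\<close>

lemma taylor_coeff_sums:
  assumes "h holomorphic_on ball 0 1" "w \<in> ball 0 1"
  shows "(\<lambda>n. taylor_coeff h n * w ^ n) sums h w"
  using holomorphic_power_series[OF assms] by (simp add: taylor_coeff_def fps_expansion_def)

text \<open>For \<open>0 < r < 1\<close> the terms \<open>norm (a n) * r ^ n\<close> are dominated
  by the sum of the two squares, both summable. So the radius of convergence is at least one and the
  power series is holomorphic on the disc.\<close>

lemma square_summable_imp_hardy_disc:
  assumes a: "summable (\<lambda>n. (norm (a n))\<^sup>2)"
  obtains h where "h \<in> hardy_disc" "taylor_coeff h = a"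
proof -
  define A where "A = Abs_fps a"
  have "summable (\<lambda>n. a n * of_real r ^ n)" if r: "0 < r" "r < 1" for r :: real
  proof (rule summable_comparison_test'[where N=0])
    have "r\<^sup>2 < 1" using r by (simp add: power_less_one_iff)
    then show "summable (\<lambda>n. (norm (a n))\<^sup>2 + (r\<^sup>2) ^ n)"
      using r by (intro summable_add a summable_geometric) simp
    fix n
    have "norm (a n) * r ^ n \<le> (norm (a n))\<^sup>2 + (r ^ n)\<^sup>2"
    proof -
      have "0 \<le> norm (a n) * r ^ n" using r by simp
      then show ?thesis
        using sum_squares_bound[of "norm (a n)" "r ^ n"] by (simp only: mult.assoc)
    qed
    then show "norm (a n * of_real r ^ n) \<le> (norm (a n))\<^sup>2 + (r\<^sup>2) ^ n"
      using r by (simp add: norm_mult norm_power power_mult[symmetric] mult.commute)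
  qed
  then have R: "fps_conv_radius A \<ge> 1"
    unfolding fps_conv_radius_def
    by (intro conv_radius_geI_ex) (auto simp: A_def intro!: exI[of _ "complex_of_real _"])
  have "ball (0::complex) 1 \<subseteq> eball 0 (fps_conv_radius A)"
  proof
    fix x :: complex assume "x \<in> ball 0 1"
    then have "ereal (norm x) < 1" by (simp add: one_ereal_def)
    also have "1 \<le> fps_conv_radius A" by (rule R)
    finally show "x \<in> eball 0 (fps_conv_radius A)" by (simp add: in_eball_iff)
  qed
  then have "eval_fps A holomorphic_on ball 0 1"
    by (rule holomorphic_on_eval_fps)
  moreover have "eval_fps A has_fps_expansion A"
    by (rule eval_fps_has_fps_expansion) (rule less_le_trans[OF _ R], simp)
  then have tc: "taylor_coeff (eval_fps A) = a"
    by (auto simp: taylor_coeff_def fps_expansion_eqI A_def)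
  ultimately have "eval_fps A \<in> hardy_disc"
    using a by (simp add: hardy_disc_def)
  then show ?thesis using tc by (rule that)
qed

lemma disc_fun_hardy:
  assumes "U \<in> hardy_circle"
  shows "disc_fun U \<in> hardy_disc" "circle_power_series (taylor_coeff (disc_fun U)) U"
proof -
  have "\<exists>h. h \<in> hardy_disc \<and> circle_power_series (taylor_coeff h) U"
    using assms square_summable_imp_hardy_disc by (force simp: hardy_circle_def)
  from someI_ex[OF this] show "disc_fun U \<in> hardy_disc" "circle_power_series (taylor_coeff (disc_fun U)) U"
    by (auto simp: disc_fun_def)
qed

text \<open>Both the Taylor coefficients of the chosen \<open>disc_fun U\<close> and the Fourier
  coefficients of \<open>U\<close> are the coefficients of one L2 expansion, so the choice does not
  matter.\<close>

lemma taylor_coeff_disc_fun: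
  "U \<in> hardy_circle \<Longrightarrow> taylor_coeff (disc_fun U) n = circle_inner U (\<lambda>z. z ^ n)"
  using circle_power_series_coeff[OF disc_fun_hardy(2)] by simp

lemma disc_fun_sums:
  assumes "U \<in> hardy_circle" "w \<in> ball 0 1"
  shows "(\<lambda>n. circle_inner U (\<lambda>z. z ^ n) * w ^ n) sums disc_fun U w"
  using taylor_coeff_sums[of "disc_fun U" w] disc_fun_hardy(1)[OF assms(1)] assms
  by (simp add: hardy_disc_def taylor_coeff_disc_fun)

lemma taylor_coeff_normalized_kernel:
  assumes "w \<in> ball 0 1"
  shows "taylor_coeff (normalized_kernel w) n = cnj w ^ n / of_real (hardy_norm (hardy_kernel w))"
proof -
  define c where "c = complex_of_real (hardy_norm (hardy_kernel w))"
  have "(\<lambda>n. fps_nth (Abs_fps (\<lambda>n. cnj w ^ n / c)) n * z ^ n) sums normalized_kernel w z"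
    if "z \<in> ball 0 1" for z
  proof -
    have "norm (cnj w * z) < 1"
      using assms that mult_strict_mono'[of "norm w" 1 "norm z" 1] by (simp add: norm_mult)
    from sums_divide[OF geometric_sums[OF this], of c] show ?thesis
      by (simp add: normalized_kernel_def hardy_kernel_def c_def power_mult_distrib)
  qed
  then have "\<forall>\<^sub>F z in nhds 0. (\<lambda>n. fps_nth (Abs_fps (\<lambda>n. cnj w ^ n / c)) n * z ^ n) sums normalized_kernel w z"
    by (intro eventually_nhds[THEN iffD2] exI[of _ "ball 0 1"]) auto
  then have "normalized_kernel w has_fps_expansion Abs_fps (\<lambda>n. cnj w ^ n / c)"
    by (rule has_fps_expansionI)
  then show ?thesis
    by (simp add: taylor_coeff_def fps_expansion_eqI c_def)
qed

subsection \<open>Reproducing kernels and Toeplitz operators\<close>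

text \<open>The geometric series of the kernel is integrated term by term; the integrals of the
  norms are \<open>norm w ^ n\<close> times the L1 norm of \<open>H\<close>. The unimodular
  \<open>e\<close> stands for either \<open>z\<close> or \<open>cnj z\<close>, so that one lemma
  serves both signs of frequency.\<close>

lemma circle_kernel_sums:
  assumes H: "integrable circle_measure H" and w: "w \<in> ball 0 1"
    and e [measurable]: "e \<in> borel_measurable circle_measure" and e1: "\<And>z. norm z = 1 \<Longrightarrow> norm (e z) = 1"
  shows "(\<lambda>n. w ^ n * (\<integral>z. e z ^ n * H z \<partial>circle_measure)) sums
    (\<integral>z. H z / (1 - w * e z) \<partial>circle_measure :: complex)"
proof -
  have int: "integrable circle_measure (\<lambda>z. e z ^ n * H z)" for n
    using H by (rule circle_integrable_mult_bounded[rotated, of _ _ 1]) (simp_all add: norm_power e1)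
  have nrm: "norm (w ^ n * (e z ^ n * H z)) = norm w ^ n * norm (H z)" if "norm z = 1" for n z
    using that by (simp add: norm_mult norm_power e1)
  have "(\<lambda>n. \<integral>z. w ^ n * (e z ^ n * H z) \<partial>circle_measure) sums
    (\<integral>z. (\<Sum>n. w ^ n * (e z ^ n * H z)) \<partial>circle_measure)"
  proof (rule sums_integral)
    show "integrable circle_measure (\<lambda>z. w ^ n * (e z ^ n * H z))" for n
      using int by simp
    show "AE z in circle_measure. summable (\<lambda>n. norm (w ^ n * (e z ^ n * H z)))"
      using w by (intro AE_I2) (simp add: nrm summable_mult2 summable_geometric)
    have "(\<integral>z. norm (w ^ n * (e z ^ n * H z)) \<partial>circle_measure) = norm w ^ n * (\<integral>z. norm (H z) \<partial>circle_measure)" for n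
    proof -
      have "(\<integral>z. norm (w ^ n * (e z ^ n * H z)) \<partial>circle_measure) = (\<integral>z. norm w ^ n * norm (H z) \<partial>circle_measure)"
        by (rule Bochner_Integration.integral_cong) (simp_all add: nrm)
      then show ?thesis by simp
    qed
    then show "summable (\<lambda>n. \<integral>z. norm (w ^ n * (e z ^ n * H z)) \<partial>circle_measure)"
      using w by (simp add: summable_mult2 summable_geometric)
  qed
  also have "(\<integral>z. (\<Sum>n. w ^ n * (e z ^ n * H z)) \<partial>circle_measure) = (\<integral>z. H z / (1 - w * e z) \<partial>circle_measure)"
  proof (rule circle_integral_cong)
    fix z :: complex assume "norm z = 1"
    then have "norm (w * e z) < 1" using w by (simp add: norm_mult e1)
    from sums_mult2[OF geometric_sums[OF this], of "H z"]
    have "(\<lambda>n. w ^ n * (e z ^ n * H z)) sums (H z / (1 - w * e z))"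
      by (simp add: power_mult_distrib mult.assoc)
    then show "(\<Sum>n. w ^ n * (e z ^ n * H z)) = H z / (1 - w * e z)"
      by (rule sums_unique[symmetric])
  qed
  finally show ?thesis by simp
qed

lemma one_minus_mult_neq_0:
  fixes a b :: complex
  assumes "norm a < 1" "norm b \<le> 1"
  shows "1 - a * b \<noteq> 0"
proof
  assume "1 - a * b = 0"
  then have "norm (a * b) = 1" by (metis eq_iff_diff_eq_0 norm_one)
  moreover have "norm (a * b) \<le> norm a"
    using assms by (simp add: norm_mult mult_left_le)
  ultimately show False using assms by linarith
qed

text \<open>On the circle the denominator has modulus at least \<open>1 - norm w\<close>, so its
  inverse is a bounded factor.\<close>

lemma circle_kernel_integrable:
  assumes H: "integrable circle_measure H" and w: "w \<in> ball 0 1"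
    and e [measurable]: "e \<in> borel_measurable circle_measure" and e1: "\<And>z. norm z = 1 \<Longrightarrow> norm (e z) = 1"
  shows "integrable circle_measure (\<lambda>z. H z / (1 - w * e z) :: complex)"
proof -
  have "integrable circle_measure (\<lambda>z. inverse (1 - w * e z) * H z)"
  proof (rule circle_integrable_mult_bounded[OF _ H, of _ "inverse (1 - norm w)"])
    fix z :: complex assume z: "norm z = 1"
    have "1 - norm w \<le> norm (1 - w * e z)"
      using norm_triangle_ineq2[of 1 "w * e z"] e1[OF z] by (simp add: norm_mult)
    then show "norm (inverse (1 - w * e z)) \<le> inverse (1 - norm w)"
      using w by (simp add: norm_inverse le_imp_inverse_le)
  qed measurable
  then show ?thesis by (simp add: field_simps)
qed

text \<open>The coefficient is the pairing of \<open>\<phi> z * B z\<close> with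
  \<open>z ^ n\<close>, where \<open>B\<close> is the boundary function of the kernel. No pointwise
  formula for \<open>B\<close> is derived: \<open>\<phi>\<close> is moved to the other side,
  \<open>B\<close> is expanded in L2, and the series is summed again under the integral.\<close>

lemma toeplitz_coeff:
  assumes \<phi>: "\<phi> \<in> circle_Linf" and w: "w \<in> ball 0 1"
  shows "taylor_coeff (toeplitz \<phi> (normalized_kernel w)) n =
    (\<integral>z. cnj z ^ n * (\<phi> z / (1 - cnj w * z)) \<partial>circle_measure) / of_real (hardy_norm (hardy_kernel w))"
proof -
  define c where "c = complex_of_real (hardy_norm (hardy_kernel w))"
  define B where "B = boundary_fun (normalized_kernel w)"
  have [measurable]: "\<phi> \<in> borel_measurable circle_measure"
    using \<phi> by (rule circle_Linf_measurable)
  have \<phi>1: "integrable circle_measure \<phi>"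
    using circle_L2_integrable_mult[OF circle_L2_Linf[OF \<phi>] circle_L2_power[of 0]] by simp
  have tc: "taylor_coeff (normalized_kernel w) = (\<lambda>n. cnj w ^ n / c)"
    using taylor_coeff_normalized_kernel[OF w] by (auto simp: c_def)
  have "(norm w)\<^sup>2 < 1" using w by (simp add: power_less_one_iff)
  then have "summable (\<lambda>n. ((norm w)\<^sup>2) ^ n / (norm c)\<^sup>2)"
    by (intro summable_divide summable_geometric) simp
  then have "summable (\<lambda>n. (norm (cnj w ^ n / c))\<^sup>2)"
    by (simp add: norm_divide norm_power power_divide power_mult[symmetric] mult.commute)
  \<comment> \<open>Riesz-Fischer supplies a witness for the choice made in
    \<open>boundary_fun\<close>.\<close>
  then obtain B' where "circle_power_series (taylor_coeff (normalized_kernel w)) B'"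
    unfolding tc by (rule circle_Riesz_Fischer)
  then have B: "circle_power_series (\<lambda>n. cnj w ^ n / c) B"
    unfolding B_def boundary_fun_def tc[symmetric]
    by (rule someI[of "circle_power_series (taylor_coeff (normalized_kernel w))"])
  then have B2: "B \<in> circle_L2" by (simp add: circle_power_series_def)
  have \<phi>B: "(\<lambda>z. \<phi> z * B z) \<in> circle_L2"
    by (rule circle_L2_Linf_mult[OF \<phi> B2])
  define K where "K = (\<lambda>z. cnj (\<phi> z) * z ^ n)"
  have "(\<lambda>z. cnj (\<phi> z)) \<in> circle_Linf"
    using \<phi> by (auto simp: circle_Linf_def intro: measurable_compose[OF _ cnj_borel_measurable])
  then have K: "K \<in> circle_L2"
    unfolding K_def by (rule circle_L2_Linf_mult[OF _ circle_L2_power])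
  have "taylor_coeff (toeplitz \<phi> (normalized_kernel w)) n = circle_inner (\<lambda>z. \<phi> z * B z) (\<lambda>z. z ^ n)"
    unfolding toeplitz_def B_def[symmetric]
    by (simp add: taylor_coeff_disc_fun P_plus_hardy \<phi>B P_plus_coeff)
  also have "\<dots> = circle_inner B K"
    by (simp add: circle_inner_def K_def mult_ac)
  finally have 1: "taylor_coeff (toeplitz \<phi> (normalized_kernel w)) n = circle_inner B K" .
  have "(\<lambda>k. cnj w ^ k / c * circle_inner (\<lambda>z. z ^ k) K) sums circle_inner B K"
    by (rule circle_power_series_inner_sums[OF B K])
  moreover have "integrable circle_measure (\<lambda>z. cnj z ^ n * \<phi> z)"
    by (rule circle_integrable_mult_bounded[OF _ \<phi>1, of _ 1]) (auto simp: norm_power)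
  then have "(\<lambda>k. cnj w ^ k * (\<integral>z. z ^ k * (cnj z ^ n * \<phi> z) \<partial>circle_measure)) sums
      (\<integral>z. cnj z ^ n * \<phi> z / (1 - cnj w * z) \<partial>circle_measure)"
    using w by (intro circle_kernel_sums) auto
  then have "(\<lambda>k. cnj w ^ k / c * circle_inner (\<lambda>z. z ^ k) K) sums
      ((\<integral>z. cnj z ^ n * \<phi> z / (1 - cnj w * z) \<partial>circle_measure) / c)"
    by (drule_tac sums_divide[where c=c]) (simp add: circle_inner_def K_def mult_ac)
  ultimately have "circle_inner B K = (\<integral>z. cnj z ^ n * \<phi> z / (1 - cnj w * z) \<partial>circle_measure) / c"
    by (rule sums_unique2)
  then show ?thesis using 1 by (simp add: c_def)
qed

text \<open>A geometric series. The kernel norms stay unevaluated, since the same product divides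
  the Toeplitz pairing below and the whole expression factors out.\<close>

lemma hardy_inner_normalized_kernels:
  assumes w1: "w1 \<in> ball 0 1" and w2: "w2 \<in> ball 0 1"
  shows "hardy_inner (normalized_kernel w1) (normalized_kernel w2) =
    1 / (1 - cnj w1 * w2) / (of_real (hardy_norm (hardy_kernel w1)) * of_real (hardy_norm (hardy_kernel w2)))"
proof -
  have "norm (cnj w1 * w2) < 1"
    using w1 w2 mult_strict_mono'[of "norm w1" 1 "norm w2" 1] by (simp add: norm_mult)
  from sums_divide[OF geometric_sums[OF this]] show ?thesis
    unfolding hardy_inner_def
    by (intro sums_unique[symmetric])
       (simp add: taylor_coeff_normalized_kernel[OF w1] taylor_coeff_normalized_kernel[OF w2] power_mult_distrib)
qed

lemma hardy_inner_toeplitz: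
  assumes \<phi>: "\<phi> \<in> circle_Linf" and w1: "w1 \<in> ball 0 1" and w2: "w2 \<in> ball 0 1"
  shows "hardy_inner (toeplitz \<phi> (normalized_kernel w1)) (normalized_kernel w2) =
    hardy_inner (normalized_kernel w1) (normalized_kernel w2) *
      (disc_fun (P_plus \<phi>) w2 + cnj (disc_fun (\<lambda>z. cnj (P_minus \<phi> z)) w1))"
proof -
  define c1 c2 where "c1 = complex_of_real (hardy_norm (hardy_kernel w1))"
    and "c2 = complex_of_real (hardy_norm (hardy_kernel w2))"
  have [measurable]: "\<phi> \<in> borel_measurable circle_measure"
    using \<phi> by (rule circle_Linf_measurable)
  have [measurable]: "cnj \<in> borel_measurable circle_measure"
    by (rule borel_measurable_circle_measure) measurable
  have \<phi>2: "\<phi> \<in> circle_L2" by (rule circle_L2_Linf[OF \<phi>])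
  have \<phi>1: "integrable circle_measure \<phi>"
    using circle_L2_integrable_mult[OF \<phi>2 circle_L2_power[of 0]] by simp
  have cw1: "cnj w1 \<in> ball 0 1" using w1 by simp
  define H where "H = (\<lambda>z. \<phi> z / (1 - cnj w1 * z))"
  have H: "integrable circle_measure H"
    unfolding H_def by (rule circle_kernel_integrable[OF \<phi>1 cw1]) auto
  have int2: "integrable circle_measure (\<lambda>z. \<phi> z / (1 - w2 * cnj z))"
    by (rule circle_kernel_integrable[OF \<phi>1 w2]) auto

  \<comment> \<open>Conjugating the Taylor coefficients of the second kernel gives the powers of
    \<open>w2\<close>, so the inner product sums to an integral against the kernel at
    \<open>w2\<close>.\<close>
  have "(\<lambda>n. w2 ^ n * (\<integral>z. cnj z ^ n * H z \<partial>circle_measure)) sums (\<integral>z. H z / (1 - w2 * cnj z) \<partial>circle_measure)"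
    by (rule circle_kernel_sums[OF H w2]) auto
  from sums_divide[OF this, of "c1 * c2"]
  have "hardy_inner (toeplitz \<phi> (normalized_kernel w1)) (normalized_kernel w2) =
      (\<integral>z. H z / (1 - w2 * cnj z) \<partial>circle_measure) / (c1 * c2)"
    unfolding hardy_inner_def
    by (intro sums_unique[symmetric])
       (simp add: toeplitz_coeff[OF \<phi> w1] taylor_coeff_normalized_kernel[OF w2] H_def c1_def c2_def mult_ac)
  \<comment> \<open>The term \<open>a / (1 - a)\<close> is written as
    \<open>1 / (1 - a) - 1\<close>, so that its product with \<open>\<phi> z\<close> is
    \<open>H z - \<phi> z\<close>.\<close>
  also have "(\<integral>z. H z / (1 - w2 * cnj z) \<partial>circle_measure) =
    (\<integral>z. (\<phi> z / (1 - w2 * cnj z) + (H z - \<phi> z)) / (1 - cnj w1 * w2) \<partial>circle_measure)"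
  proof (rule circle_integral_cong)
    fix z :: complex assume z: "norm z = 1"
    then have zz: "z * cnj z = 1" by (simp add: complex_norm_square[symmetric])
    have nz: "1 - cnj w1 * z \<noteq> 0" "1 - w2 * cnj z \<noteq> 0" "1 - cnj w1 * w2 \<noteq> 0"
      by (rule one_minus_mult_neq_0; use w1 w2 z in simp)+
    define a b where "a = cnj w1 * z" and "b = w2 * cnj z"
    have ab: "cnj w1 * w2 = a * b"
    proof -
      have "a * b = cnj w1 * w2 * (z * cnj z)" by (simp add: a_def b_def mult_ac)
      then show ?thesis by (simp add: zz)
    qed
    have "1 / ((1 - a) * (1 - b)) = (1 / (1 - b) + (1 / (1 - a) - 1)) / (1 - a * b)"
      using nz unfolding ab a_def[symmetric] b_def[symmetric] by (simp add: divide_simps) algebra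
    then have "\<phi> z * (1 / ((1 - a) * (1 - b))) = \<phi> z * ((1 / (1 - b) + (1 / (1 - a) - 1)) / (1 - a * b))"
      by simp
    then show "H z / (1 - w2 * cnj z) = (\<phi> z / (1 - w2 * cnj z) + (H z - \<phi> z)) / (1 - cnj w1 * w2)"
      unfolding H_def ab a_def[symmetric] b_def[symmetric] by (simp add: algebra_simps)
  qed
  also have "\<dots> = ((\<integral>z. \<phi> z / (1 - w2 * cnj z) \<partial>circle_measure) +
      ((\<integral>z. H z \<partial>circle_measure) - (\<integral>z. \<phi> z \<partial>circle_measure))) / (1 - cnj w1 * w2)"
    using int2 H \<phi>1 by simp
  \<comment> \<open>The coefficients of \<open>P_plus \<phi>\<close> are those of
    \<open>\<phi>\<close> of nonnegative index, so expanding the kernel gives the Taylor series at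
    \<open>w2\<close>.\<close>
  also have "(\<integral>z. \<phi> z / (1 - w2 * cnj z) \<partial>circle_measure) = disc_fun (P_plus \<phi>) w2"
  proof -
    have "(\<lambda>n. w2 ^ n * (\<integral>z. cnj z ^ n * \<phi> z \<partial>circle_measure)) sums (\<integral>z. \<phi> z / (1 - w2 * cnj z) \<partial>circle_measure)"
      by (rule circle_kernel_sums[OF \<phi>1 w2]) auto
    moreover have "(\<lambda>n. w2 ^ n * (\<integral>z. cnj z ^ n * \<phi> z \<partial>circle_measure)) sums disc_fun (P_plus \<phi>) w2"
      using disc_fun_sums[OF P_plus_hardy[OF \<phi>2] w2]
      unfolding P_plus_coeff[OF \<phi>2] by (simp add: circle_inner_def mult_ac)
    ultimately show ?thesis by (rule sums_unique2)
  qed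
  also have "(\<integral>z. H z \<partial>circle_measure) - (\<integral>z. \<phi> z \<partial>circle_measure) = cnj (disc_fun (\<lambda>z. cnj (P_minus \<phi> z)) w1)"
  proof -
    have f: "P_plus \<phi> \<in> circle_L2" "P_plus \<phi> \<in> hardy_circle"
      using P_plus_hardy[OF \<phi>2] hardy_circle_L2 by auto
    \<comment> \<open>The integral of \<open>z ^ n * \<phi> z\<close> is the Fourier coefficient of
      index \<open>-n\<close>. The constant term belongs to \<open>P_plus \<phi>\<close>, hence the
      correction at \<open>n = 0\<close>.\<close>
    have coeff: "cnj (circle_inner (\<lambda>z. cnj (P_minus \<phi> z)) (\<lambda>z. z ^ n)) =
        (\<integral>z. z ^ n * \<phi> z \<partial>circle_measure) - (if n = 0 then \<integral>z. \<phi> z \<partial>circle_measure else 0)" for n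
    proof -
      have "cnj (circle_inner (\<lambda>z. cnj (P_minus \<phi> z)) (\<lambda>z. z ^ n)) = circle_inner (P_minus \<phi>) (\<lambda>z. cnj z ^ n)"
        unfolding circle_inner_def Bochner_Integration.integral_cnj[symmetric] by simp
      also have "\<dots> = circle_inner \<phi> (\<lambda>z. cnj z ^ n) - circle_inner (P_plus \<phi>) (\<lambda>z. cnj z ^ n)"
        unfolding P_minus_def using circle_L2_cnj[OF circle_L2_power[of n]]
        by (intro circle_inner_diff_left \<phi>2 f) simp
      also have "circle_inner \<phi> (\<lambda>z. cnj z ^ n) = (\<integral>z. z ^ n * \<phi> z \<partial>circle_measure)"
        by (simp add: circle_inner_def mult.commute)
      also have "circle_inner (P_plus \<phi>) (\<lambda>z. cnj z ^ n) = (if n = 0 then \<integral>z. \<phi> z \<partial>circle_measure else 0)"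
      proof (cases "n = 0")
        case True
        then show ?thesis using P_plus_coeff[OF \<phi>2, of 0] by (simp add: circle_inner_def)
      next
        case False
        then show ?thesis
          using circle_power_series_cnj_coeff[OF disc_fun_hardy(2)[OF f(2)], of n] by simp
      qed
      finally show ?thesis .
    qed
    have "(\<lambda>n. cnj (circle_inner (\<lambda>z. cnj (P_minus \<phi> z)) (\<lambda>z. z ^ n) * w1 ^ n)) sums
        cnj (disc_fun (\<lambda>z. cnj (P_minus \<phi> z)) w1)"
      by (subst sums_cnj) (rule disc_fun_sums[OF cnj_P_minus_hardy[OF \<phi>2] w1])
    then have S: "(\<lambda>n. cnj w1 ^ n * (\<integral>z. z ^ n * \<phi> z \<partial>circle_measure) -
          (if n = 0 then \<integral>z. \<phi> z \<partial>circle_measure else 0)) sums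
        cnj (disc_fun (\<lambda>z. cnj (P_minus \<phi> z)) w1)"
      by (rule sums_cong[THEN iffD1, rotated]) (simp add: coeff algebra_simps)
    have "(\<lambda>n. cnj w1 ^ n * (\<integral>z. z ^ n * \<phi> z \<partial>circle_measure)) sums (\<integral>z. H z \<partial>circle_measure)"
      unfolding H_def by (rule circle_kernel_sums[OF \<phi>1 cw1]) auto
    \<comment> \<open>The correction is a series with a single nonzero term, so it sums to the
      integral of \<open>\<phi>\<close>.\<close>
    then have "(\<lambda>n. cnj w1 ^ n * (\<integral>z. z ^ n * \<phi> z \<partial>circle_measure) -
          (if n = 0 then \<integral>z. \<phi> z \<partial>circle_measure else 0)) sums
        ((\<integral>z. H z \<partial>circle_measure) - (\<integral>z. \<phi> z \<partial>circle_measure))"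
      by (intro sums_diff sums_single)
    then show ?thesis by (rule sums_unique2[OF _ S])
  qed
  finally show ?thesis
    unfolding hardy_inner_normalized_kernels[OF w1 w2] c1_def c2_def by simp
qed

theorem corollary3p11:
  fixes q :: real and \<phi> f g :: "complex \<Rightarrow> complex"
  assumes "0 < q" and "q \<le> 1"
    and "\<phi> \<in> circle_Linf"
    and "\<forall>w\<in>ball 0 1. \<phi> w = harmonic_extension \<phi> w"
    and "f = P_plus \<phi>" and "g = P_minus \<phi>"
  shows "f \<in> hardy_circle \<and> (\<lambda>z. cnj (g z)) \<in> hardy_circle \<and>
    berezin_range q (toeplitz \<phi>) =
      {of_real q * (disc_fun f w2 + cnj (disc_fun (\<lambda>z. cnj (g z)) w1)) | w1 w2.
         w1 \<in> ball 0 1 \<and> w2 \<in> berezin_partners q w1}"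
proof (intro conjI)
  have \<phi>2: "\<phi> \<in> circle_L2" by (rule circle_L2_Linf[OF assms(3)])
  show "f \<in> hardy_circle"
    unfolding assms(5) by (rule P_plus_hardy[OF \<phi>2])
  show "(\<lambda>z. cnj (g z)) \<in> hardy_circle"
    unfolding assms(6) by (rule cnj_P_minus_hardy[OF \<phi>2])
  \<comment> \<open>Membership of \<open>w2\<close> in \<open>berezin_partners q w1\<close> says
    that the kernel inner product in \<open>hardy_inner_toeplitz\<close> equals
    \<open>q\<close>.\<close>
  have "hardy_inner (toeplitz \<phi> (normalized_kernel w1)) (normalized_kernel w2) =
      of_real q * (disc_fun f w2 + cnj (disc_fun (\<lambda>z. cnj (g z)) w1))"
    if "w1 \<in> ball 0 1" "w2 \<in> berezin_partners q w1" for w1 w2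
    using that hardy_inner_toeplitz[OF assms(3) that(1), of w2]
    by (simp add: berezin_partners_def assms(5,6))
  then show "berezin_range q (toeplitz \<phi>) =
      {of_real q * (disc_fun f w2 + cnj (disc_fun (\<lambda>z. cnj (g z)) w1)) | w1 w2.
         w1 \<in> ball 0 1 \<and> w2 \<in> berezin_partners q w1}"
    unfolding berezin_range_def by metis
qed

end
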